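(* Consider a polygonal grid with cell set $\mathcal C$ and node set $\mathcal N$. For $\mathbf v=(\mathbf v_c)_{c\in\mathcal C}$, $\mathbf v_c\in\mathbb R^2$, define the node-centered operator $$(C\mathbf v)_n := -\frac{1}{|c_n|}\sum_{c\in\mathcal C(n)} \ell_{nc}\mathbf n_{nc}\times \mathbf v_c,\qquad n\in\mathcal N .$$ Then: (i) $C$ is a weakly consistent discretization of the curl $\nabla\times\mathbf v$ at the nodes, in the sense that it satisfies the following discrete analogue of $\int (\nabla\times \mathbf v)\,\phi\,d\mathbf x=-\int \nabla\phi\times\mathbf v\,d\mathbf x$ (up to boundary terms): for every $\mathbf v=(\mathbf v_c)_{c\in\mathcal C}$ and every scalar function $\phi=(\phi_n)_{n\in\mathcal N}$ on the nodes (with only finitely many nonzero values if the grid is infinite), $$\sum_{n\in\mathcal N} (C\mathbf v)_n\,\phi_n\,|c_n| = -\sum_{c\in\mathcal C} \big((\mathbf G\phi)_c\times \mathbf v_c\big)\,|c| .$$ (ii) If every cell $c\in\mathcal C$ has at most four edges, then $\mathrm{im}\,\mathbf G\subset\ker C$, i.e. $(C(\mathbf G\phi))_n=0$ for every $n\in\mathcal N$ and every $\phi=(\phi_n)_{n\in\mathcal N}$.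
   Context: The grid is a locally finite, edge-to-edge tiling, without boundary, of $\mathbb R^2$ or of a flat torus (doubly periodic domain) by simple polygonal cells; the vertices of each cell are pairwise distinct nodes, and every edge is shared by exactly two cells. $\mathcal C$ and $\mathcal N$ are the sets of cells and nodes; $\mathcal C(n)$ is the set of cells having $n$ as a vertex; $\mathcal N(c)$ is the set of vertices of cell $c$. $|c|$ is the area of $c$. Each edge $e$ is cut at its midpoint into two subedges of length $|e|/2$, one adjacent to each endpoint. $\mathcal{SE}(n,c)$ is the set of the two subedges of the boundary of $c$ adjacent to its vertex $n$; $|s|$ is the length of subedge $s$, and $\mathbf n_{s,c}$ is the unit normal to $s$ pointing out of $c$. The node-normal is $\ell_{nc}\mathbf n_{nc}:=\sum_{s\in\mathcal{SE}(n,c)}|s|\,\mathbf n_{s,c}$ (with $|\mathbf n_{nc}|=1$). $c_n$ is the dual cell of node $n$: the polygonal region whose vertices are the centroids of all cells in $\mathcal C(n)$ and the midpoints of all edges containing $n$; $|c_n|>0$ is its area. The discrete gradient is $(\mathbf G\phi)_c := \frac{1}{|c|}\sum_{n\in\mathcal N(c)}\ell_{nc}\mathbf n_{nc}\,\phi_n\in\mathbb R^2$. For $\mathbf a,\mathbf b\in\mathbb R^2$, $\mathbf a\times\mathbf b:=a_1b_2-a_2b_1$. *)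

theory Defs
  imports "HOL-Analysis.Analysis"
begin

type_synonym plane = "real^2"

definition cross2 :: "plane \<Rightarrow> plane \<Rightarrow> real" where
  "cross2 a b = a $ 1 * b $ 2 - a $ 2 * b $ 1"

subsection \<open>Simple polygons\<close>

text \<open>A polygon is given by the cyclic list of its vertices, in either orientation.
  Interior angles equal to \<open>\<pi>\<close> are allowed.\<close>

definition edge :: "plane list \<Rightarrow> nat \<Rightarrow> plane set" where
  "edge p i = closed_segment (p ! i) (p ! (Suc i mod length p))"

definition edges :: "plane list \<Rightarrow> plane set set" where
  "edges p = edge p ` {..<length p}"

definition simple_polygon :: "plane list \<Rightarrow> bool" where
  "simple_polygon p \<longleftrightarrow> 3 \<le> length p \<and> distinct p \<and>
     (\<forall>i < length p. \<forall>j < length p. i \<noteq> j \<longrightarrow>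
        edge p i \<inter> edge p j \<subseteq>
          {p ! i, p ! (Suc i mod length p)} \<inter> {p ! j, p ! (Suc j mod length p)})"

text \<open>The closed region enclosed by a closed curve.\<close>

definition enclosed :: "plane set \<Rightarrow> plane set" where
  "enclosed B = B \<union> inside B"

definition region :: "plane list \<Rightarrow> plane set" where
  "region p = enclosed (\<Union>(edges p))"

definition area :: "plane list \<Rightarrow> real" where
  "area p = measure lebesgue (region p)"

definition centroid :: "plane list \<Rightarrow> plane" where
  "centroid p = (1 / area p) *\<^sub>R integral (region p) (\<lambda>x. x)"

text \<open>A subedge is the pair of its adjacent vertex and the midpoint of the edge it belongs to.\<close>

definition subedges_at :: "plane list \<Rightarrow> plane \<Rightarrow> (plane \<times> plane) set" where
  "subedges_at p x = {(x, midpoint x y) | y. closed_segment x y \<in> edges p}"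

definition sublength :: "plane \<times> plane \<Rightarrow> real" where
  "sublength s = dist (fst s) (snd s)"

text \<open>``Pointing out of the polygon'' is tested at the midpoint of the subedge, which is a
  relative interior point of the edge.\<close>

definition outer_normal :: "plane list \<Rightarrow> plane \<times> plane \<Rightarrow> plane" where
  "outer_normal p s = (THE u. norm u = 1 \<and> u \<bullet> (snd s - fst s) = 0 \<and>
     (\<forall>\<^sub>F t in at_right (0::real). midpoint (fst s) (snd s) + t *\<^sub>R u \<notin> region p))"

subsection \<open>Polygonal grids\<close>

text \<open>The plane and the flat tori are treated together as quotients of the plane by a group
  \<open>\<Lambda>\<close> of translations (the field \<open>periods\<close>), which is trivial for the plane and a lattice of
  rank two for a torus. The list \<open>verts c\<close> describes one lift of the cell \<open>c\<close> to the plane;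
  the tiles are all lifts of all cells. A node is a coset \<open>x + \<Lambda>\<close>, i.e. the set of all its
  lifts, so that in the planar case it is the singleton of its position.\<close>

record 'c grid =
  periods :: "plane set"
  cells :: "'c set"
  verts :: "'c \<Rightarrow> plane list"

definition tile :: "'c grid \<Rightarrow> 'c \<Rightarrow> plane \<Rightarrow> plane list" where
  "tile G c l = map ((+) l) (verts G c)"

definition node :: "'c grid \<Rightarrow> plane \<Rightarrow> plane set" where
  "node G x = (\<lambda>l. x + l) ` periods G"

definition nodes_of :: "'c grid \<Rightarrow> 'c \<Rightarrow> plane set set" where
  "nodes_of G c = node G ` set (verts G c)"

definition nodes :: "'c grid \<Rightarrow> plane set set" where
  "nodes G = (\<Union>c\<in>cells G. nodes_of G c)"

definition cells_at :: "'c grid \<Rightarrow> plane set \<Rightarrow> 'c set" where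
  "cells_at G n = {c \<in> cells G. n \<in> nodes_of G c}"

locale polygonal_grid =
  fixes G :: "'c grid"
  assumes plane_or_torus:
      "periods G = {0} \<or>
       (\<exists>a b. cross2 a b \<noteq> 0 \<and>
          periods G = {of_int i *\<^sub>R a + of_int j *\<^sub>R b | i j. True})"
    and simple_cells: "\<And>c. c \<in> cells G \<Longrightarrow> simple_polygon (verts G c)"
    and distinct_nodes: "\<And>c. c \<in> cells G \<Longrightarrow> inj_on (node G) (set (verts G c))"
    and covering: "(\<Union>c\<in>cells G. \<Union>l\<in>periods G. region (tile G c l)) = UNIV"
    and nonoverlapping:
      "\<And>c c' l l'. \<lbrakk>c \<in> cells G; c' \<in> cells G; l \<in> periods G; l' \<in> periods G;
          (c, l) \<noteq> (c', l')\<rbrakk> \<Longrightarrow>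
         interior (region (tile G c l)) \<inter> interior (region (tile G c' l')) = {}"
    and edge_to_edge:
      "\<And>c c' l l'. \<lbrakk>c \<in> cells G; c' \<in> cells G; l \<in> periods G; l' \<in> periods G;
          (c, l) \<noteq> (c', l')\<rbrakk> \<Longrightarrow>
         region (tile G c l) \<inter> region (tile G c' l') =
           \<Union>(edges (tile G c l) \<inter> edges (tile G c' l')) \<union>
           (set (tile G c l) \<inter> set (tile G c' l'))"
    and locally_finite:
      "\<And>x. \<exists>r>0. finite {(c, l). c \<in> cells G \<and> l \<in> periods G \<and>
                              region (tile G c l) \<inter> ball x r \<noteq> {}}"
    and edge_shared_by_two:
      "\<And>c e. \<lbrakk>c \<in> cells G; e \<in> edges (verts G c)\<rbrakk> \<Longrightarrow>
         card {c' \<in> cells G. \<exists>l\<in>periods G. e \<in> edges (tile G c' l)} = 2"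

subsection \<open>Node-normals, dual cells and the discrete operators\<close>

text \<open>By \<open>distinct_nodes\<close>, \<open>n \<inter> set (verts G c)\<close> has exactly one element when \<open>n\<close> is a node
  of \<open>c\<close>.\<close>

definition SE :: "'c grid \<Rightarrow> plane set \<Rightarrow> 'c \<Rightarrow> (plane \<times> plane) set" where
  "SE G n c = (\<Union>x \<in> n \<inter> set (verts G c). subedges_at (verts G c) x)"

text \<open>The vector \<open>\<ell>\<^sub>n\<^sub>c n\<^sub>n\<^sub>c\<close>; its length and direction only ever occur through this product.\<close>

definition node_normal :: "'c grid \<Rightarrow> plane set \<Rightarrow> 'c \<Rightarrow> plane" where
  "node_normal G n c = (\<Sum>s\<in>SE G n c. sublength s *\<^sub>R outer_normal (verts G c) s)"

text \<open>The boundary of the dual cell joins the midpoint of each edge at \<open>x\<close> to the centroids of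
  the tiles having this edge.\<close>

definition dual_boundary :: "'c grid \<Rightarrow> plane \<Rightarrow> plane set" where
  "dual_boundary G x =
     \<Union>{closed_segment (midpoint x y) (centroid (tile G c l)) | y c l.
         c \<in> cells G \<and> l \<in> periods G \<and> closed_segment x y \<in> edges (tile G c l)}"

text \<open>The area does not depend on the lift of the node.\<close>

definition dual_area :: "'c grid \<Rightarrow> plane set \<Rightarrow> real" where
  "dual_area G n = measure lebesgue (enclosed (dual_boundary G (SOME x. x \<in> n)))"

definition grad :: "'c grid \<Rightarrow> (plane set \<Rightarrow> real) \<Rightarrow> 'c \<Rightarrow> plane" where
  "grad G \<phi> c = (1 / area (verts G c)) *\<^sub>R (\<Sum>n\<in>nodes_of G c. \<phi> n *\<^sub>R node_normal G n c)"

definition curl :: "'c grid \<Rightarrow> ('c \<Rightarrow> plane) \<Rightarrow> plane set \<Rightarrow> real" where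
  "curl G v n = - (1 / dual_area G n) * (\<Sum>c\<in>cells_at G n. cross2 (node_normal G n c) (v c))"

end

theory Submission
  imports Defs
begin

text \<open>
Part (i) is an interchange of summations: both sides equal, up to sign, the sum over all incident
pairs of a node \<open>n\<close> and a cell \<open>c\<close> of \<open>\<phi> n\<close> times the cross product of the node-normal with
\<open>v c\<close> (\<open>summation_by_parts\<close>). The interchange is between finite sums because local finiteness
leaves finitely many cells at each node (\<open>finite_cells_at\<close>). Since the gradient is defined by
division by the cell area, the area must not vanish; this holds for every simple polygon by the
Jordan--Brouwer separation theorem (\<open>area_pos\<close>).

For part (ii), list the vertices of a cell counterclockwise. The node-normal at a vertex is half of
the vector from its successor to its predecessor, rotated by a quarter turn
(\<open>vertex_normal_ccw\<close>). For triangles and quadrilaterals, the normals at adjacent vertices have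
cross product plus or minus half of the area, and those at opposite vertices are antiparallel.
So the contribution of the cell to the curl of a gradient at a node is, up to sign, half of the
difference of the values of \<open>\<phi>\<close> at the two neighbours of the node on the cell
(\<open>cross2_vertex_normal_sum\<close>), whatever the shape of the cell. Around the node each edge is shared
by two cells lying on opposite sides, for one of which it leads to the successor and for the other
to the predecessor. Hence the contributions cancel (\<open>curl_grad_zero\<close>).

This needs the area and the side of the region for a polygon whose region is defined topologically.
A simple quadrilateral, even with a reflex or straight angle, is cut by one of its diagonals into
two triangles of the same orientation (\<open>simple_quadrilateral_diagonal_splits\<close>). The union of the
two triangles is starlike, which suffices to see that it is the enclosed region
(\<open>enclosed_starlike\<close>), and area and sides can be read off from the triangles.
\<close>

section \<open>Simple polygons have positive area\<close>

text \<open>Passing to one more edge keeps the path an arc: since the vertices are pairwise distinct, an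
earlier edge can meet the new one only in the vertex at which the path has arrived.\<close>

lemma arc_along_edges:
  assumes "simple_polygon p" "k \<noteq> 0" "k < length p"
  shows "\<exists>g. arc g \<and> pathstart g = p ! 0 \<and> pathfinish g = p ! k
               \<and> path_image g = (\<Union>i<k. edge p i)"
  using assms(2,3)
proof (induction k)
  case 0
  then show ?case by simp
next
  case (Suc k)
  have dist: "distinct p"
    and meet: "\<And>i j. \<lbrakk>i < length p; j < length p; i \<noteq> j\<rbrakk> \<Longrightarrow>
        edge p i \<inter> edge p j \<subseteq> {p ! i, p ! (Suc i mod length p)} \<inter> {p ! j, p ! (Suc j mod length p)}"
    using assms(1) by (auto simp: simple_polygon_def)
  have ne: "p ! k \<noteq> p ! Suc k"
    using dist Suc.prems by (simp add: nth_eq_iff_index_eq)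
  have ek: "edge p k = closed_segment (p ! k) (p ! Suc k)"
    using Suc.prems by (simp add: edge_def)
  show ?case
  proof (cases "k = 0")
    case True
    have "arc (linepath (p ! 0) (p ! 1))"
      using ne True by (simp add: arc_linepath)
    then show ?thesis
      using True ek by (intro exI[of _ "linepath (p ! 0) (p ! 1)"]) auto
  next
    case False
    then obtain g where g: "arc g" "pathstart g = p ! 0" "pathfinish g = p ! k"
        "path_image g = (\<Union>i<k. edge p i)"
      using Suc by auto
    have "path_image g \<inter> path_image (linepath (p ! k) (p ! Suc k)) \<subseteq> {p ! k}"
    proof
      fix z assume "z \<in> path_image g \<inter> path_image (linepath (p ! k) (p ! Suc k))"
      then obtain i where i: "i < k" "z \<in> edge p i" "z \<in> edge p k"
        using g(4) ek by auto
      then have "z \<in> {p ! i, p ! Suc i} \<inter> {p ! k, p ! Suc k}"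
        using meet[of i k] Suc.prems by auto
      moreover have "p ! Suc k \<noteq> p ! i" "p ! Suc k \<noteq> p ! Suc i"
        using dist i(1) Suc.prems by (auto simp: nth_eq_iff_index_eq)
      ultimately show "z \<in> {p ! k}" by auto
    qed
    moreover have "arc (linepath (p ! k) (p ! Suc k))"
      using ne by (simp add: arc_linepath)
    ultimately have "arc (g +++ linepath (p ! k) (p ! Suc k))"
      using g by (intro arc_join) auto
    moreover have "path_image (g +++ linepath (p ! k) (p ! Suc k)) = (\<Union>i<Suc k. edge p i)"
      using g ek by (simp add: path_image_join lessThan_Suc Un_commute)
    ultimately show ?thesis
      using g by (intro exI[of _ "g +++ linepath (p ! k) (p ! Suc k)"]) auto
  qed
qed

lemma simple_closed_path_along_polygon:
  assumes "simple_polygon p"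
  shows "\<exists>g. simple_path g \<and> pathfinish g = pathstart g \<and> path_image g = \<Union>(edges p)"
proof -
  obtain n where n: "length p = Suc n" "n \<noteq> 0"
    using assms by (cases "length p") (auto simp: simple_polygon_def)
  obtain g where g: "arc g" "pathstart g = p ! 0" "pathfinish g = p ! n"
      "path_image g = (\<Union>i<n. edge p i)"
    using arc_along_edges[OF assms, of n] n by auto
  have en: "edge p n = closed_segment (p ! n) (p ! 0)"
    using n by (simp add: edge_def)
  have meet: "edge p i \<inter> edge p n \<subseteq> {p ! n, p ! 0}" if "i < n" for i
    using assms that n unfolding simple_polygon_def
    by (metis Int_subset_iff less_Suc_eq less_irrefl mod_self)
  have "path_image g \<inter> path_image (linepath (p ! n) (p ! 0)) \<subseteq> {p ! 0, p ! n}"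
    using meet g(4) en by auto
  moreover have "arc (linepath (p ! n) (p ! 0))"
    using assms n by (auto simp: simple_polygon_def nth_eq_iff_index_eq intro!: arc_linepath)
  ultimately have "simple_path (g +++ linepath (p ! n) (p ! 0))"
    using g by (intro simple_path_join_loop) auto
  moreover have "path_image (g +++ linepath (p ! n) (p ! 0)) = \<Union>(edges p)"
    using g en n by (simp add: path_image_join edges_def lessThan_Suc Un_commute)
  ultimately show ?thesis
    using g by (intro exI[of _ "g +++ linepath (p ! n) (p ! 0)"]) auto
qed

lemma vertices_in_region:
  assumes "x \<in> set p"
  shows "x \<in> region p"
proof -
  obtain i where "i < length p" "x = p ! i"
    using assms by (auto simp: in_set_conv_nth)
  then have "x \<in> \<Union>(edges p)"
    unfolding edges_def edge_def by auto
  then show ?thesis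
    by (simp add: region_def enclosed_def)
qed

lemma region_cong: "edges p = edges q \<Longrightarrow> region p = region q"
  by (simp add: region_def)

lemma area_cong: "edges p = edges q \<Longrightarrow> area p = area q"
  by (simp add: area_def region_def)

lemma compact_boundary: "compact (\<Union>(edges p))"
  unfolding edges_def edge_def by (intro compact_Union) auto

lemma compact_region: "compact (region p)"
proof -
  have "region p = - outside (\<Union>(edges p))"
    by (simp add: region_def enclosed_def union_with_inside)
  moreover have "open (outside (\<Union>(edges p)))"
    by (intro open_outside compact_imp_closed compact_boundary)
  moreover have "bounded (- outside (\<Union>(edges p)))"
    by (intro cobounded_outside compact_imp_bounded compact_boundary)
  ultimately show ?thesis
    by (metis closed_Compl compact_eq_bounded_closed)
qed

text \<open>The boundary is homeomorphic to a circle, so by the Jordan--Brouwer theorem its complement is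
disconnected. The outside is connected, hence the inside, an open set, is nonempty.\<close>

lemma area_pos:
  assumes "simple_polygon p"
  shows "area p > 0"
proof -
  define B where "B = \<Union>(edges p)"
  obtain g where g: "simple_path g" "pathfinish g = pathstart g" "path_image g = B"
    using simple_closed_path_along_polygon[OF assms] B_def by auto
  have "B homeomorphic sphere (0::complex) 1"
    using homeomorphic_simple_path_image_circle[OF g(1,2), of 1 0] g(3) by simp
  moreover have "sphere (0::complex) 1 homeomorphic sphere (0::plane) 1"
    by (rule homeomorphic_spheres_gen) auto
  ultimately have "\<not> connected (- B)"
    using Jordan_Brouwer_separation[of B 0 1] homeomorphic_trans by fastforce
  moreover have "connected (outside B)"
    unfolding B_def by (intro connected_outside compact_imp_bounded compact_boundary) simp
  ultimately have ne: "inside B \<noteq> {}"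
    using inside_Un_outside[of B] by force
  have op: "open (inside B)"
    unfolding B_def by (intro open_inside compact_imp_closed compact_boundary)
  have "\<not> negligible (region p)"
    using open_not_negligible[OF op ne] negligible_subset
    unfolding region_def enclosed_def B_def by blast
  moreover have "region p \<in> lmeasurable"
    by (intro lmeasurable_compact compact_region)
  ultimately show ?thesis
    unfolding area_def by (metis measure_nonneg negligible_iff_measure0 order_less_le)
qed

section \<open>Orientation and triangles\<close>

text \<open>Twice the signed area of the triangle \<open>a b c\<close>: positive iff \<open>c\<close> lies to the left of the line
from \<open>a\<close> to \<open>b\<close>. As a function of \<open>c\<close> it is affine.\<close>

definition orient :: "plane \<Rightarrow> plane \<Rightarrow> plane \<Rightarrow> real" where
  "orient a b c = cross2 (b - a) (c - a)"

text \<open>The rotation by a quarter turn counterclockwise, so that \<open>perp (y - x)\<close> points to the left of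
the direction from \<open>x\<close> to \<open>y\<close>.\<close>

definition perp :: "plane \<Rightarrow> plane" where
  "perp v = vector [- v $ 2, v $ 1]"

lemma perp_nth [simp]: "perp v $ 1 = - v $ 2" "perp v $ 2 = v $ 1"
  by (simp_all add: perp_def)

lemma orient_rotate: "orient b c a = orient a b c"
  by (simp add: orient_def cross2_def algebra_simps)

lemma orient_reverse: "orient b a c = - orient a b c"
  by (simp add: orient_def cross2_def algebra_simps)

lemma orient_swap: "orient a c b = - orient a b c"
  by (simp add: orient_def cross2_def algebra_simps)

lemma orient_convex_combination:
  "orient p q ((1 - t) *\<^sub>R u + t *\<^sub>R v) = (1 - t) * orient p q u + t * orient p q v"
  by (simp add: orient_def cross2_def algebra_simps)

lemma orient_add: "orient p q (m + t *\<^sub>R w) = orient p q m + t * cross2 (q - p) w"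
  by (simp add: orient_def cross2_def algebra_simps)

lemma orient_self [simp]: "orient a b a = 0" "orient a b b = 0" "orient a a b = 0"
  by (simp_all add: orient_def cross2_def)

lemma cross2_perp: "cross2 v (perp v) = v \<bullet> v"
  by (simp add: cross2_def inner_vec_def sum_2 algebra_simps)

lemma norm_perp [simp]: "norm (perp v) = norm v"
  by (simp add: norm_eq_sqrt_inner inner_vec_def sum_2 algebra_simps)

lemma perp_minus: "perp (u - v) = perp u - perp v"
  by (simp add: vec_eq_iff forall_2)

lemma continuous_on_orient [continuous_intros]:
  "continuous_on S (orient a b)"
  unfolding orient_def cross2_def by (intro continuous_intros)

lemma orient_eq_inner: "orient a b z = perp (b - a) \<bullet> z - perp (b - a) \<bullet> a"
  by (simp add: orient_def cross2_def inner_vec_def sum_2 algebra_simps)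

lemma convex_orient_nonneg: "convex {z. orient a b z \<ge> 0}"
  using convex_halfspace_ge[of "perp (b - a) \<bullet> a" "perp (b - a)"]
  by (simp add: orient_eq_inner algebra_simps)

text \<open>The values of \<open>orient\<close> on the three sides, divided by \<open>orient a b c\<close>, are the barycentric
coordinates of \<open>z\<close>.\<close>

lemma triangle_eq_halfplanes:
  assumes "orient a b c > 0"
  shows "convex hull {a, b, c} =
    {z. orient a b z \<ge> 0 \<and> orient b c z \<ge> 0 \<and> orient c a z \<ge> 0}" (is "_ = ?H")
proof (rule antisym)
  have "convex ?H"
    using convex_orient_nonneg[of a b] convex_orient_nonneg[of b c] convex_orient_nonneg[of c a]
    by (simp add: Collect_conj_eq convex_Int)
  moreover have "{a, b, c} \<subseteq> ?H"
    using assms orient_rotate by (auto simp: less_imp_le)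
  ultimately show "convex hull {a, b, c} \<subseteq> ?H"
    by (simp add: hull_minimal)
next
  show "?H \<subseteq> convex hull {a, b, c}"
  proof
    fix z assume z: "z \<in> ?H"
    let ?d = "orient a b c"
    \<comment> \<open>The barycentric coordinates add up to 1.\<close>
    have s: "orient b c z + orient c a z + orient a b z = ?d"
      by (simp add: orient_def cross2_def algebra_simps)
    have "?d *\<^sub>R z = orient b c z *\<^sub>R a + orient c a z *\<^sub>R b + orient a b z *\<^sub>R c"
      by (simp add: vec_eq_iff forall_2 orient_def cross2_def algebra_simps)
    then have "(1 / ?d) *\<^sub>R (?d *\<^sub>R z) = (1 / ?d) *\<^sub>R (orient b c z *\<^sub>R a + orient c a z *\<^sub>R b + orient a b z *\<^sub>R c)"
      by simp
    then have "z = (orient b c z / ?d) *\<^sub>R a + (orient c a z / ?d) *\<^sub>R b + (orient a b z / ?d) *\<^sub>R c"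
      using assms by (simp add: scaleR_add_right)
    moreover have "orient b c z / ?d + orient c a z / ?d + orient a b z / ?d = 1"
      using s assms by (simp add: add_divide_distrib[symmetric])
    ultimately show "z \<in> convex hull {a, b, c}"
      using z assms unfolding convex_hull_3 by (force intro!: divide_nonneg_pos)
  qed
qed

lemma frontier_triangle:
  "frontier (convex hull {a, b, c :: plane}) = closed_segment a b \<union> closed_segment b c \<union> closed_segment c a"
  by (rule frontier_of_triangle) simp

lemma open_triangle_subset_interior:
  assumes "orient a b c > 0" "orient a b z > 0" "orient b c z > 0" "orient c a z > 0"
  shows "z \<in> interior (convex hull {a, b, c})"
proof -
  let ?U = "{z. orient a b z > 0 \<and> orient b c z > 0 \<and> orient c a z > 0}"
  have "open ?U"
    by (intro open_Collect_conj open_Collect_less continuous_intros)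
  moreover have "?U \<subseteq> convex hull {a, b, c}"
    by (auto simp: triangle_eq_halfplanes[OF assms(1)])
  ultimately show ?thesis
    using assms by (intro interiorI[of ?U]) auto
qed

section \<open>Regions of triangles and quadrilaterals\<close>

text \<open>This identifies the region of a polygon once a candidate \<open>Q\<close> for it is known. A point outside the
starlike set \<open>Q\<close> escapes to infinity along the ray from the centre through it, without meeting
\<open>Q\<close>. A connected set avoiding \<open>B\<close>, and thus the frontier of \<open>Q\<close>, cannot leave the bounded set
\<open>Q\<close>. Starlikeness in place of convexity admits quadrilaterals with a reflex angle.\<close>

lemma enclosed_starlike:
  assumes "bounded Q" "x0 \<in> Q" "\<And>x. x \<in> Q \<Longrightarrow> closed_segment x0 x \<subseteq> Q"
    and B: "B \<subseteq> Q" "frontier Q \<subseteq> B"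
  shows "enclosed B = (Q :: plane set)"
proof -
  have "x \<in> Q" if "x \<notin> outside B" for x
  proof (rule ccontr)
    assume x: "x \<notin> Q"
    then have "x \<noteq> x0" using assms(2) by blast
    have out: "x0 + t *\<^sub>R (x - x0) \<notin> Q" if "t \<ge> 1" for t
    proof
      assume "x0 + t *\<^sub>R (x - x0) \<in> Q"
      then have "closed_segment x0 (x0 + t *\<^sub>R (x - x0)) \<subseteq> Q"
        by (rule assms(3))
      moreover have "x \<in> closed_segment x0 (x0 + t *\<^sub>R (x - x0))"
        using that by (intro in_segment(1)[THEN iffD2] exI[of _ "1 / t"]) (auto simp: algebra_simps)
      ultimately show False using x by blast
    qed
    let ?R = "(\<lambda>t. x0 + t *\<^sub>R (x - x0)) ` {1..}"
    have "connected ?R"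
      by (intro connected_continuous_image continuous_intros) simp
    moreover have "x \<in> ?R" by (intro image_eqI[of _ _ 1]) auto
    moreover have "?R \<subseteq> - B" using out B by auto
    ultimately have sub: "?R \<subseteq> connected_component_set (- B) x"
      by (intro connected_component_maximal)
    have "\<not> bounded ?R"
    proof
      assume "bounded ?R"
      then obtain C where C: "\<And>t. t \<ge> 1 \<Longrightarrow> norm (x0 + t *\<^sub>R (x - x0)) \<le> C"
        by (auto simp: bounded_iff)
      \<comment> \<open>Far enough for the ray to leave the ball of radius \<open>C\<close>.\<close>
      let ?t = "1 + (\<bar>C\<bar> + norm x0) / norm (x - x0)"
      have "?t * norm (x - x0) = norm (?t *\<^sub>R (x - x0))"
        by simp
      also have "\<dots> \<le> norm (x0 + ?t *\<^sub>R (x - x0)) + norm x0"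
        by (metis add_diff_cancel_left' norm_triangle_ineq4)
      also have "\<dots> \<le> C + norm x0"
        using C[of ?t] by simp
      finally have "?t * norm (x - x0) \<le> C + norm x0" .
      moreover have "?t * norm (x - x0) = norm (x - x0) + \<bar>C\<bar> + norm x0"
        using \<open>x \<noteq> x0\<close> by (simp add: field_simps)
      moreover have "norm (x - x0) > 0"
        using \<open>x \<noteq> x0\<close> by simp
      ultimately show False
        by linarith
    qed
    then have "x \<in> outside B"
      using sub bounded_subset unfolding outside by blast
    then show False using that by simp
  qed
  moreover have "x \<notin> outside B" if "x \<in> Q" for x
  proof
    assume "x \<in> outside B"
    then have unb: "\<not> bounded (connected_component_set (- B) x)" and "x \<notin> B"
      by (auto simp: outside_def)
    then have xC: "x \<in> connected_component_set (- B) x" by simp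
    have "connected_component_set (- B) x \<inter> frontier Q = {}"
      using connected_component_subset[of "- B" x] B by blast
    then have "connected_component_set (- B) x \<subseteq> Q"
      using connected_Int_frontier[of "connected_component_set (- B) x" Q] that xC
        connected_connected_component[of "- B" x] by blast
    then show False using unb assms(1) bounded_subset by blast
  qed
  ultimately show ?thesis
    unfolding enclosed_def union_with_inside by blast
qed

text \<open>The region \<open>R\<close> lies, locally, exactly to the left of the directed segment from \<open>x\<close> to \<open>y\<close>. The
two parts serve different ends: that points on the left are interior makes two such regions
overlap, and that points on the right are missing determines the outer normal.\<close>

definition left_of :: "plane set \<Rightarrow> plane \<Rightarrow> plane \<Rightarrow> bool" where
  "left_of R x y \<longleftrightarrow> (\<forall>m\<in>open_segment x y. \<exists>e>0. \<forall>t. 0 < t \<and> t < e \<longrightarrow>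
     m + t *\<^sub>R perp (y - x) \<in> interior R \<and> m - t *\<^sub>R perp (y - x) \<notin> R)"

text \<open>Two cells sharing an edge must therefore traverse it in opposite directions.\<close>

lemma left_of_same_edge_interiors_meet:
  assumes "a \<noteq> b" "left_of R a b" "left_of S a b"
  shows "interior R \<inter> interior S \<noteq> {}"
proof -
  have m: "midpoint a b \<in> open_segment a b"
    using assms(1) by simp
  obtain d where d: "d > 0" "\<And>t. 0 < t \<and> t < d \<Longrightarrow> midpoint a b + t *\<^sub>R perp (b - a) \<in> interior R"
    using assms(2) m unfolding left_of_def by meson
  obtain e where e: "e > 0" "\<And>t. 0 < t \<and> t < e \<Longrightarrow> midpoint a b + t *\<^sub>R perp (b - a) \<in> interior S"
    using assms(3) m unfolding left_of_def by meson
  have "midpoint a b + (min d e / 2) *\<^sub>R perp (b - a) \<in> interior R \<inter> interior S"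
    using d(2)[of "min d e / 2"] e(2)[of "min d e / 2"] d(1) e(1) by auto
  then show ?thesis
    by blast
qed

lemma small_step_in_open:
  fixes m w :: plane
  assumes "open U" "m \<in> U"
  shows "\<exists>e>0. \<forall>t. \<bar>t\<bar> < e \<longrightarrow> m + t *\<^sub>R w \<in> U"
proof -
  have "open ((\<lambda>t. m + t *\<^sub>R w) -` U)"
    by (intro open_vimage assms continuous_intros)
  moreover have "0 \<in> (\<lambda>t. m + t *\<^sub>R w) -` U"
    using assms by simp
  ultimately obtain e where "e > 0" "ball 0 e \<subseteq> (\<lambda>t. m + t *\<^sub>R w) -` U"
    using open_contains_ball by blast
  then show ?thesis
    by (intro exI[of _ e]) (auto simp: subset_iff dist_real_def)
qed

lemma orient_open_segment:
  assumes "m \<in> open_segment a b"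
  shows "\<exists>t. 0 < t \<and> t < 1 \<and> (\<forall>p q. orient p q m = (1 - t) * orient p q a + t * orient p q b)"
  using assms orient_convex_combination unfolding in_segment by blast

lemma left_of_triangle:
  assumes "orient a b c > 0"
  shows "left_of (convex hull {a, b, c}) a b"
  unfolding left_of_def
proof
  fix m assume "m \<in> open_segment a b"
  then obtain s where s: "0 < s" "s < 1"
      and m: "\<And>p q. orient p q m = (1 - s) * orient p q a + s * orient p q b"
    using orient_open_segment by blast
  have "b \<noteq> a" using assms by auto
  let ?U = "{z. orient b c z > 0 \<and> orient c a z > 0}"
  have "open ?U"
    by (intro open_Collect_conj open_Collect_less continuous_intros)
  moreover have "m \<in> ?U"
    using s assms orient_rotate[of a b c] orient_rotate[of b c a] by (simp add: m)
  ultimately obtain e where e: "e > 0" "\<And>t. \<bar>t\<bar> < e \<Longrightarrow> m + t *\<^sub>R perp (b - a) \<in> ?U"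
    using small_step_in_open by meson
  have side: "orient a b (m + t *\<^sub>R perp (b - a)) = t * ((b - a) \<bullet> (b - a))" for t
    by (simp add: orient_add cross2_perp m)
  have pos: "(b - a) \<bullet> (b - a) > 0"
    using \<open>b \<noteq> a\<close> by simp
  show "\<exists>e>0. \<forall>t. 0 < t \<and> t < e \<longrightarrow> m + t *\<^sub>R perp (b - a) \<in> interior (convex hull {a, b, c})
          \<and> m - t *\<^sub>R perp (b - a) \<notin> convex hull {a, b, c}"
  proof (intro exI[of _ e] conjI allI impI e(1))
    fix t assume t: "0 < t \<and> t < e"
    show "m + t *\<^sub>R perp (b - a) \<in> interior (convex hull {a, b, c})"
      using t e(2)[of t] side[of t] pos assms by (intro open_triangle_subset_interior) auto
    show "m - t *\<^sub>R perp (b - a) \<notin> convex hull {a, b, c}"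
    proof -
      have "orient a b (m - t *\<^sub>R perp (b - a)) < 0"
        using side[of "- t"] mult_pos_pos[of t "(b - a) \<bullet> (b - a)"] pos t by simp
      then show ?thesis
        by (simp add: triangle_eq_halfplanes[OF assms])
    qed
  qed
qed

text \<open>Gluing a second closed set along another side does not change what happens near the segment.\<close>

lemma left_of_Un:
  assumes "left_of R x y" "closed T" "open_segment x y \<inter> T = {}"
  shows "left_of (R \<union> T) x y"
  unfolding left_of_def
proof
  fix m assume m: "m \<in> open_segment x y"
  obtain e where e: "e > 0" "\<And>t. 0 < t \<and> t < e \<Longrightarrow>
      m + t *\<^sub>R perp (y - x) \<in> interior R \<and> m - t *\<^sub>R perp (y - x) \<notin> R"
    using assms(1) m unfolding left_of_def by meson
  obtain d where d: "d > 0" "\<And>t. \<bar>t\<bar> < d \<Longrightarrow> m + t *\<^sub>R perp (y - x) \<in> - T"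
    using small_step_in_open[of "- T" m "perp (y - x)"] assms(2,3) m by auto
  show "\<exists>e>0. \<forall>t. 0 < t \<and> t < e \<longrightarrow> m + t *\<^sub>R perp (y - x) \<in> interior (R \<union> T)
          \<and> m - t *\<^sub>R perp (y - x) \<notin> R \<union> T"
  proof (intro exI[of _ "min d e"] conjI allI impI)
    fix t assume t: "0 < t \<and> t < min d e"
    show "m + t *\<^sub>R perp (y - x) \<in> interior (R \<union> T)"
      using e(2)[of t] t interior_mono[of R "R \<union> T"] by auto
    show "m - t *\<^sub>R perp (y - x) \<notin> R \<union> T"
      using e(2)[of t] d(2)[of "- t"] t by auto
  qed (use d e in auto)
qed

lemma content_positive_triangle:
  assumes "orient a b c > 0"
  shows "measure lebesgue (convex hull {a, b, c}) = orient a b c / 2"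
proof -
  have "measure lebesgue (convex hull {a, b, c}) = measure lborel (convex hull {a, b, c})"
    by (intro measure_completion) (simp add: compact_imp_closed finite_imp_compact_convex_hull borel_closed)
  also have "\<dots> = \<bar>orient a b c\<bar> / 2"
    unfolding content_triangle by (simp add: orient_def cross2_def algebra_simps abs_minus_commute)
  finally show ?thesis using assms by simp
qed

lemma compact_triangle: "compact (convex hull {a, b, c :: plane})"
  by (simp add: finite_imp_compact_convex_hull)

lemma edges_triangle:
  "edges [a, b, c] = {closed_segment a b, closed_segment b c, closed_segment c a}"
  by (auto simp: edges_def edge_def lessThan_Suc)

lemma edges_quadrilateral:
  "edges [a, b, c, d] = {closed_segment a b, closed_segment b c, closed_segment c d, closed_segment d a}"
  by (auto simp: edges_def edge_def lessThan_Suc)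

lemma region_triangle:
  assumes "orient a b c > 0"
  shows "region [a, b, c] = convex hull {a, b, c}"
  unfolding region_def
proof (rule enclosed_starlike)
  show "a \<in> convex hull {a, b, c}"
    by (simp add: hull_inc)
  then show "closed_segment a x \<subseteq> convex hull {a, b, c}" if "x \<in> convex hull {a, b, c}" for x
    using that by (simp add: closed_segment_subset)
  have "\<Union> (edges [a, b, c]) = frontier (convex hull {a, b, c})"
    by (auto simp: edges_triangle frontier_triangle)
  moreover have "frontier (convex hull {a, b, c}) \<subseteq> convex hull {a, b, c}"
    by (intro frontier_subset_closed compact_imp_closed compact_triangle)
  ultimately show "\<Union> (edges [a, b, c]) \<subseteq> convex hull {a, b, c}"
      "frontier (convex hull {a, b, c}) \<subseteq> \<Union> (edges [a, b, c])"
    by simp_all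
  show "bounded (convex hull {a, b, c})"
    by (intro compact_imp_bounded compact_triangle)
qed

text \<open>The two triangles share the vertex \<open>a\<close> and are convex, so their union is starlike about \<open>a\<close>.
Its frontier consists of the four sides only: near a point strictly inside the diagonal, the
inequalities for the four sides are strict, and every point lies on one side of the diagonal,
that is, in one of the triangles.\<close>

lemma region_quadrilateral:
  assumes "orient a b c > 0" "orient a c d > 0"
  shows "region [a, b, c, d] = convex hull {a, b, c} \<union> convex hull {a, c, d}"
    (is "_ = ?T \<union> ?S")
  unfolding region_def
proof (rule enclosed_starlike)
  have a: "a \<in> ?T" "a \<in> ?S"
    by (simp_all add: hull_inc)
  then show "a \<in> ?T \<union> ?S" by simp
  show "closed_segment a x \<subseteq> ?T \<union> ?S" if "x \<in> ?T \<union> ?S" for x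
    using that a closed_segment_subset[of a _ x] by (metis Un_iff convex_convex_hull le_supI1 le_supI2)
  show "bounded (?T \<union> ?S)"
    by (intro bounded_Un[THEN iffD2] conjI compact_imp_bounded compact_triangle)
  have fT: "frontier ?T \<subseteq> ?T" and fS: "frontier ?S \<subseteq> ?S"
    by (intro frontier_subset_closed compact_imp_closed compact_triangle)+
  show "\<Union> (edges [a, b, c, d]) \<subseteq> ?T \<union> ?S"
    using fT fS by (auto simp: edges_quadrilateral frontier_triangle)
  have diag: "open_segment a c \<subseteq> interior (?T \<union> ?S)"
  proof
    fix m assume "m \<in> open_segment a c"
    then obtain s where s: "0 < s" "s < 1"
        and m: "\<And>p q. orient p q m = (1 - s) * orient p q a + s * orient p q c"
      using orient_open_segment by blast
    let ?U = "{z. orient a b z > 0 \<and> orient b c z > 0 \<and> orient c d z > 0 \<and> orient d a z > 0}"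
    have "open ?U"
      by (intro open_Collect_conj open_Collect_less continuous_intros)
    moreover have "m \<in> ?U"
      using s assms orient_rotate[of b c a] orient_rotate[of a c d] orient_rotate[of d a c] by (simp add: m)
    moreover have "?U \<subseteq> ?T \<union> ?S"
    proof
      fix z assume "z \<in> ?U"
      moreover have "orient c a z \<ge> 0 \<or> orient a c z \<ge> 0"
        by (simp add: orient_def cross2_def algebra_simps) linarith
      ultimately show "z \<in> ?T \<union> ?S"
        by (auto simp: triangle_eq_halfplanes assms)
    qed
    ultimately show "m \<in> interior (?T \<union> ?S)"
      by (intro interiorI[of ?U])
  qed
  show "frontier (?T \<union> ?S) \<subseteq> \<Union> (edges [a, b, c, d])"
  proof
    fix z assume z: "z \<in> frontier (?T \<union> ?S)"
    then have "z \<notin> open_segment a c"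
      using diag by (auto simp: frontier_def)
    moreover have "z \<in> frontier ?T \<union> frontier ?S"
      using z frontier_Un_subset by blast
    ultimately show "z \<in> \<Union> (edges [a, b, c, d])"
      by (auto simp: edges_quadrilateral frontier_triangle closed_segment_eq_open open_segment_commute)
  qed
qed

lemma area_triangle:
  assumes "orient a b c > 0"
  shows "area [a, b, c] = orient a b c / 2"
  by (simp add: area_def region_triangle content_positive_triangle assms)

lemma area_quadrilateral:
  assumes "orient a b c > 0" "orient a c d > 0"
  shows "area [a, b, c, d] = (orient a b c + orient a c d) / 2"
proof -
  let ?T = "convex hull {a, b, c}" and ?S = "convex hull {a, c, d}"
  have "?T \<inter> ?S \<subseteq> {z. perp (c - a) \<bullet> z = perp (c - a) \<bullet> a}"
  proof
    fix z assume "z \<in> ?T \<inter> ?S"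
    then have "orient a c z \<ge> 0" "orient c a z \<ge> 0"
      by (auto simp: triangle_eq_halfplanes assms)
    then have "orient a c z = 0"
      by (simp add: orient_def cross2_def algebra_simps)
    then show "z \<in> {z. perp (c - a) \<bullet> z = perp (c - a) \<bullet> a}"
      by (simp add: orient_eq_inner)
  qed
  moreover have "perp (c - a) \<noteq> 0"
  proof
    assume "perp (c - a) = 0"
    then have "c = a"
      using norm_perp[of "c - a"] by simp
    then show False
      using assms by simp
  qed
  ultimately have "negligible (?T \<inter> ?S)"
    using negligible_hyperplane negligible_subset by blast
  then have "measure lebesgue (?T \<union> ?S) = measure lebesgue ?T + measure lebesgue ?S"
    by (simp add: measure_Un3 lmeasurable_compact compact_triangle negligible_imp_measure0)
  then show ?thesis
    by (simp add: area_def region_quadrilateral content_positive_triangle assms add_divide_distrib)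
qed

lemma left_of_region_triangle:
  assumes "orient a b c > 0"
  shows "left_of (region [a, b, c]) a b" "left_of (region [a, b, c]) b c"
    "left_of (region [a, b, c]) c a"
  using left_of_triangle[of a b c] left_of_triangle[of b c a] left_of_triangle[of c a b]
    orient_rotate[of a b c] orient_rotate[of b c a] assms
  by (simp_all add: region_triangle insert_commute)

lemma left_of_region_quadrilateral:
  assumes "orient a b c > 0" "orient a c d > 0"
  shows "left_of (region [a, b, c, d]) a b" "left_of (region [a, b, c, d]) b c"
    "left_of (region [a, b, c, d]) c d" "left_of (region [a, b, c, d]) d a"
proof -
  let ?T = "convex hull {a, b, c}" and ?S = "convex hull {a, c, d}"
  have b: "orient a c b < 0" using assms(1) orient_swap[of a c b] by simp
  have d: "orient c a d < 0" using assms(2) orient_reverse[of c a d] by simp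
  have S: "orient a c z \<ge> 0" if "z \<in> ?S" for z
    using that assms by (auto simp: triangle_eq_halfplanes)
  have T: "orient c a z \<ge> 0" if "z \<in> ?T" for z
    using that assms by (auto simp: triangle_eq_halfplanes)
  have "orient a c m < 0" if "m \<in> open_segment a b \<union> open_segment b c" for m
    using that b orient_open_segment[of m a b] orient_open_segment[of m b c]
    by (force simp: mult_pos_neg)
  then have 1: "open_segment a b \<inter> ?S = {}" "open_segment b c \<inter> ?S = {}"
    using S by (meson Un_iff disjoint_iff not_le)+
  have "orient c a m < 0" if "m \<in> open_segment c d \<union> open_segment d a" for m
    using that d orient_open_segment[of m c d] orient_open_segment[of m d a]
    by (force simp: mult_pos_neg)
  then have 2: "open_segment c d \<inter> ?T = {}" "open_segment d a \<inter> ?T = {}"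
    using T by (meson Un_iff disjoint_iff not_le)+
  have cl: "closed ?S" "closed ?T"
    by (intro compact_imp_closed compact_triangle)+
  show "left_of (region [a, b, c, d]) a b" "left_of (region [a, b, c, d]) b c"
    using left_of_Un[OF _ cl(1) 1(1)] left_of_Un[OF _ cl(1) 1(2)] left_of_region_triangle[OF assms(1)]
    by (simp_all add: region_quadrilateral region_triangle assms)
  show "left_of (region [a, b, c, d]) c d" "left_of (region [a, b, c, d]) d a"
    using left_of_Un[OF _ cl(2) 2(1)] left_of_Un[OF _ cl(2) 2(2)] left_of_region_triangle[OF assms(2)]
    unfolding region_quadrilateral[OF assms] Un_commute[of ?T]
    by (simp_all add: region_triangle assms)
qed

section \<open>Simple polygons with at most four vertices\<close>

text \<open>If the boundary does not fold back at \<open>b\<close>, then an angle that is degenerate there is \<open>\<pi>\<close> and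
not \<open>0\<close>.\<close>

lemma straight_angle_between:
  assumes "distinct [a, b, c]" "orient a b c = 0"
    and "closed_segment a b \<inter> closed_segment b c \<subseteq> {b}"
  shows "\<exists>t. 0 < t \<and> t < 1 \<and> b = (1 - t) *\<^sub>R a + t *\<^sub>R c"
proof -
  have "((b - a) \<bullet> (b - a)) *\<^sub>R (c - a) = ((c - a) \<bullet> (b - a)) *\<^sub>R (b - a) + orient a b c *\<^sub>R perp (b - a)"
    by (simp add: vec_eq_iff forall_2 inner_vec_def sum_2 orient_def cross2_def algebra_simps)
  then have "((b - a) \<bullet> (b - a)) *\<^sub>R (c - a) = ((c - a) \<bullet> (b - a)) *\<^sub>R (b - a)"
    by (simp add: assms(2))
  moreover have "(b - a) \<bullet> (b - a) \<noteq> 0"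
    using assms(1) by auto
  ultimately have "c - a = (((c - a) \<bullet> (b - a)) / ((b - a) \<bullet> (b - a))) *\<^sub>R (b - a)"
    by (simp add: eq_vector_fraction_iff)
  then have "collinear {0, b - a, c - a}"
    by (metis collinear_lemma)
  then have "collinear {b, a, c}"
    by (simp add: collinear_3[of b a c])
  then have "collinear {a, b, c}"
    by (simp add: insert_commute)
  then have "b \<in> closed_segment a c \<or> a \<in> closed_segment b c \<or> c \<in> closed_segment a b"
    by (metis between_mem_segment collinear_between_cases closed_segment_commute)
  then have "b \<in> closed_segment a c"
    using assms(1,3) by auto
  then have "b \<in> open_segment a c"
    using assms(1) by (auto simp: open_segment_def)
  then show ?thesis
    unfolding in_segment by blast
qed

lemma simple_quadrilateral_edges_meet:
  assumes "simple_polygon [a, b, c, d]"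
  shows "closed_segment a b \<inter> closed_segment b c \<subseteq> {b}"
    and "closed_segment b c \<inter> closed_segment c d \<subseteq> {c}"
    and "closed_segment c d \<inter> closed_segment d a \<subseteq> {d}"
    and "closed_segment d a \<inter> closed_segment a b \<subseteq> {a}"
    and "closed_segment a b \<inter> closed_segment c d = {}"
    and "closed_segment b c \<inter> closed_segment d a = {}"
proof -
  let ?p = "[a, b, c, d]"
  have dist: "distinct ?p"
    using assms unfolding simple_polygon_def by blast
  have meet: "edge ?p i \<inter> edge ?p j \<subseteq>
      {?p ! i, ?p ! (Suc i mod 4)} \<inter> {?p ! j, ?p ! (Suc j mod 4)}"
    if "i < 4" "j < 4" "i \<noteq> j" for i j
  proof -
    have "length ?p = 4" by simp
    then show ?thesis
      using assms that unfolding simple_polygon_def by metis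
  qed
  show "closed_segment a b \<inter> closed_segment b c \<subseteq> {b}"
    using meet[of 0 1] dist by (auto simp: edge_def)
  show "closed_segment b c \<inter> closed_segment c d \<subseteq> {c}"
    using meet[of 1 2] dist by (auto simp: edge_def)
  show "closed_segment c d \<inter> closed_segment d a \<subseteq> {d}"
    using meet[of 2 3] dist by (auto simp: edge_def)
  show "closed_segment d a \<inter> closed_segment a b \<subseteq> {a}"
    using meet[of 3 0] dist by (auto simp: edge_def)
  show "closed_segment a b \<inter> closed_segment c d = {}"
    using meet[of 0 2] dist by (auto simp: edge_def)
  show "closed_segment b c \<inter> closed_segment d a = {}"
    using meet[of 1 3] dist by (auto simp: edge_def)
qed

text \<open>With an angle \<open>\<pi>\<close> at \<open>b\<close>, the diagonal from \<open>b\<close> splits the triangle \<open>a c d\<close>. If that triangle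
were flat, then \<open>b\<close> and \<open>d\<close> would both lie between \<open>a\<close> and \<open>c\<close>, and the one nearer to \<open>a\<close>
would lie on both of the sides that meet in \<open>a\<close>.\<close>

lemma straight_angle_diagonal_splits:
  assumes "distinct [a, b, c, d]" "orient a b c = 0"
    and ab_bc: "closed_segment a b \<inter> closed_segment b c \<subseteq> {b}"
    and cd_da: "closed_segment c d \<inter> closed_segment d a \<subseteq> {d}"
    and da_ab: "closed_segment d a \<inter> closed_segment a b \<subseteq> {a}"
  shows "orient a b d * orient b c d > 0"
proof -
  obtain t where t: "0 < t" "t < 1" "b = (1 - t) *\<^sub>R a + t *\<^sub>R c"
    using straight_angle_between[OF _ assms(2) ab_bc] assms(1) by auto
  have prod: "orient a b d * orient b c d = (t * (1 - t)) * (orient a c d * orient a c d)"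
    unfolding t(3) by (simp add: orient_def cross2_def algebra_simps)
  have "orient a c d \<noteq> 0"
  proof
    assume "orient a c d = 0"
    then have "orient c d a = 0"
      by (simp add: orient_rotate)
    then obtain s where s: "0 < s" "s < 1" "d = (1 - s) *\<^sub>R c + s *\<^sub>R a"
      using straight_angle_between[OF _ _ cd_da] assms(1) by auto
    show False
    proof (cases "t \<le> 1 - s")
      case True
      have "b \<in> closed_segment a d"
        unfolding in_segment
      proof (intro exI conjI)
        have "(1 - r) *\<^sub>R a + r *\<^sub>R d = a + (r * (1 - s)) *\<^sub>R (c - a)" for r
          unfolding s(3) by (simp add: vec_eq_iff forall_2 algebra_simps)
        from this[of "t / (1 - s)"] have "(1 - t / (1 - s)) *\<^sub>R a + (t / (1 - s)) *\<^sub>R d = a + t *\<^sub>R (c - a)"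
          using s by simp
        also have "\<dots> = b"
          unfolding t(3) by (simp add: algebra_simps)
        finally show "b = (1 - t / (1 - s)) *\<^sub>R a + (t / (1 - s)) *\<^sub>R d"
          by simp
      qed (use True t s in auto)
      then show False
        using da_ab assms(1) by (auto simp: closed_segment_commute)
    next
      case False
      have "d \<in> closed_segment a b"
        unfolding in_segment
      proof (intro exI conjI)
        have "(1 - r) *\<^sub>R a + r *\<^sub>R b = a + (r * t) *\<^sub>R (c - a)" for r
          unfolding t(3) by (simp add: vec_eq_iff forall_2 algebra_simps)
        from this[of "(1 - s) / t"] have "(1 - (1 - s) / t) *\<^sub>R a + ((1 - s) / t) *\<^sub>R b = a + (1 - s) *\<^sub>R (c - a)"
          using t by simp
        also have "\<dots> = d"
          unfolding s(3) by (simp add: algebra_simps)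
        finally show "d = (1 - (1 - s) / t) *\<^sub>R a + ((1 - s) / t) *\<^sub>R b"
          by simp
      qed (use False t s in auto)
      then show False
        using da_ab assms(1) by auto
    qed
  qed
  then show ?thesis
    unfolding prod using t by (auto simp: zero_less_mult_iff linorder_neq_iff)
qed

lemma segments_cross:
  assumes "orient a b c * orient a b d < 0" "orient c d a * orient c d b < 0"
  shows "closed_segment a b \<inter> closed_segment c d \<noteq> {}"
proof -
  \<comment> \<open>The parameters of the crossing point: \<open>orient c d\<close> is affine along \<open>a b\<close> and vanishes there.\<close>
  define s where "s = orient c d a / (orient c d a - orient c d b)"
  define t where "t = orient a b c / (orient a b c - orient a b d)"
  have s: "0 \<le> s" "s \<le> 1" and ds: "orient c d a - orient c d b \<noteq> 0"
    using assms(2) unfolding s_def by (auto simp: mult_less_0_iff field_simps)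
  have t: "0 \<le> t" "t \<le> 1" and dt: "orient a b c - orient a b d \<noteq> 0"
    using assms(1) unfolding t_def by (auto simp: mult_less_0_iff field_simps)
  have "(1 - s) *\<^sub>R a + s *\<^sub>R b = (1 - t) *\<^sub>R c + t *\<^sub>R d"
  proof -
    \<comment> \<open>Both denominators are \<open>\<plusminus>D\<close>; multiplying by \<open>D\<close> leaves a polynomial identity.\<close>
    define D where "D = cross2 (b - a) (d - c)"
    have D: "orient c d a - orient c d b = D" "orient a b c - orient a b d = - D"
      by (simp_all add: D_def orient_def cross2_def algebra_simps)
    then have "D \<noteq> 0" using dt by simp
    have "D *\<^sub>R ((1 - s) *\<^sub>R a + s *\<^sub>R b) = D *\<^sub>R a + (D * s) *\<^sub>R (b - a)"
      by (simp add: algebra_simps)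
    also have "D * s = orient c d a"
      using \<open>D \<noteq> 0\<close> by (simp add: s_def D)
    also have "D *\<^sub>R a + orient c d a *\<^sub>R (b - a) = D *\<^sub>R c + (- orient a b c) *\<^sub>R (d - c)"
      by (simp add: D_def vec_eq_iff forall_2 orient_def cross2_def algebra_simps)
    also have "- orient a b c = D * t"
      using \<open>D \<noteq> 0\<close> by (simp add: t_def D)
    also have "D *\<^sub>R c + (D * t) *\<^sub>R (d - c) = D *\<^sub>R ((1 - t) *\<^sub>R c + t *\<^sub>R d)"
      by (simp add: algebra_simps)
    finally show ?thesis
      using \<open>D \<noteq> 0\<close> by simp
  qed
  then have "(1 - s) *\<^sub>R a + s *\<^sub>R b \<in> closed_segment c d"
    using t unfolding in_segment by metis
  moreover have "(1 - s) *\<^sub>R a + s *\<^sub>R b \<in> closed_segment a b"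
    using s unfolding in_segment by metis
  ultimately have "(1 - s) *\<^sub>R a + s *\<^sub>R b \<in> closed_segment a b \<inter> closed_segment c d"
    by blast
  then show ?thesis by blast
qed

text \<open>Angles \<open>\<pi>\<close> are covered by \<open>straight_angle_diagonal_splits\<close>, so all four orientations
may be taken nonzero. If neither diagonal separated the other two vertices, each of the two products
would have factors of opposite signs. Up to a global sign this leaves two sign patterns, and each
of them makes a pair of opposite sides cross.\<close>

lemma simple_quadrilateral_diagonal_splits:
  assumes "simple_polygon [a, b, c, d]"
  shows "orient a b c * orient a c d > 0 \<or> orient b c d * orient b d a > 0"
proof (rule ccontr)
  assume "\<not> ?thesis"
  then have neg: "orient a b c * orient a c d \<le> 0" "orient b c d * orient b d a \<le> 0"
    by auto
  note meet = simple_quadrilateral_edges_meet[OF assms]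
  have dist: "distinct [a, b, c, d]"
    using assms unfolding simple_polygon_def by blast
  have cyc: "orient a b d = orient b d a" "orient b c a = orient a b c" "orient c d a = orient a c d"
      "orient c d b = orient b c d" "orient d a b = orient b d a" "orient d a c = orient a c d"
      "orient c a b = orient a b c" "orient d b c = orient b c d"
    by (simp_all add: orient_def cross2_def algebra_simps)
  have "orient a b c \<noteq> 0"
    using straight_angle_diagonal_splits[of a b c d] dist meet neg cyc by (auto simp: mult.commute)
  moreover have "orient b c d \<noteq> 0"
    using straight_angle_diagonal_splits[of b c d a] dist meet neg cyc by (auto simp: mult.commute)
  moreover have "orient a c d \<noteq> 0"
    using straight_angle_diagonal_splits[of c d a b] dist meet neg cyc by (auto simp: mult.commute)
  moreover have "orient b d a \<noteq> 0"
    using straight_angle_diagonal_splits[of d a b c] dist meet neg cyc by (auto simp: mult.commute)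
  ultimately have neg': "orient a b c * orient a c d < 0" "orient b c d * orient b d a < 0"
    using neg by (auto simp: order_less_le)
  then have "orient a b c * orient a b d < 0 \<and> orient c d a * orient c d b < 0 \<or>
      orient b c d * orient b c a < 0 \<and> orient d a b * orient d a c < 0"
    unfolding cyc by (auto simp: mult_less_0_iff)
  then show False
    using segments_cross[of a b c d] segments_cross[of b c d a] meet(5,6) by argo
qed

text \<open>Counterclockwise listings of triangles and quadrilaterals, possibly with an angle \<open>\<ge> \<pi>\<close>. A
quadrilateral is required to be cut by one of its diagonals into two positively oriented
triangles; both diagonals have to be admitted, since only one of them works if there is such an
angle, and since this makes the notion invariant under rotation of the list.\<close>

definition ccw :: "plane list \<Rightarrow> bool" where
  "ccw q \<longleftrightarrow>
     (\<exists>a b c. q = [a, b, c] \<and> orient a b c > 0) \<or>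
     (\<exists>a b c d. q = [a, b, c, d] \<and>
        (orient a b c > 0 \<and> orient a c d > 0 \<or> orient b c d > 0 \<and> orient b d a > 0))"

lemma ccw_rotate1: "ccw q \<Longrightarrow> ccw (rotate1 q)"
  unfolding ccw_def by (auto simp: orient_rotate) 

lemma edges_rotate1: "ccw q \<Longrightarrow> edges (rotate1 q) = edges q"
  unfolding ccw_def by (auto simp: edges_triangle edges_quadrilateral)

lemma ccw_distinct:
  assumes "ccw q"
  shows "distinct q"
  using assms
  unfolding ccw_def
proof (elim disjE exE conjE)
  fix a b c d assume "q = [a, b, c, d]" "orient a b c > 0" "orient a c d > 0"
  then show ?thesis
    using orient_swap[of a b c] by auto
next
  fix a b c d assume "q = [a, b, c, d]" "orient b c d > 0" "orient b d a > 0"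
  then show ?thesis
    using orient_swap[of b c d] by auto
qed auto

text \<open>Reversing the list changes the signs of all orientations and none of the edges.\<close>

lemma ccw_listing_exists:
  assumes "simple_polygon p" "length p \<le> 4"
  shows "\<exists>q. ccw q \<and> set q = set p \<and> edges q = edges p"
proof -
  have "length p = 3 \<or> length p = 4"
    using assms unfolding simple_polygon_def by linarith
  then show ?thesis
  proof
    assume "length p = 3"
    then obtain a b c where p: "p = [a, b, c]"
      by (auto simp: eval_nat_numeral length_Suc_conv)
    have d: "distinct [a, b, c]"
      using assms(1) unfolding p simple_polygon_def by blast
    have meet: "edge p i \<inter> edge p j \<subseteq> {p ! i, p ! (Suc i mod 3)} \<inter> {p ! j, p ! (Suc j mod 3)}"
      if "i < 3" "j < 3" "i \<noteq> j" for i j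
      using assms(1) that unfolding simple_polygon_def \<open>length p = 3\<close> by blast
    have ab_bc: "closed_segment a b \<inter> closed_segment b c \<subseteq> {b}"
      using meet[of 0 1] d by (auto simp: edge_def p)
    have bc_ca: "closed_segment b c \<inter> closed_segment c a \<subseteq> {c}"
      using meet[of 1 2] d by (auto simp: edge_def p)
    have "orient a b c \<noteq> 0"
    proof
      assume "orient a b c = 0"
      then have "b \<in> closed_segment a c"
        using straight_angle_between[OF d _ ab_bc] unfolding in_segment by (meson less_imp_le)
      then show False
        using bc_ca d by (auto simp: closed_segment_commute)
    qed
    then have "orient a b c > 0 \<or> orient a c b > 0"
      using orient_swap[of a b c] by linarith
    then have "ccw [a, b, c] \<or> ccw [a, c, b]"
      by (auto simp: ccw_def)
    moreover have "edges [a, c, b] = edges [a, b, c]"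
      by (auto simp: edges_triangle closed_segment_commute)
    moreover have "set [a, c, b] = set [a, b, c]"
      by auto
    ultimately show ?thesis
      unfolding p by metis
  next
    assume "length p = 4"
    then obtain a b c d where p: "p = [a, b, c, d]"
      by (auto simp: eval_nat_numeral length_Suc_conv)
    have "orient a b c * orient a c d > 0 \<or> orient b c d * orient b d a > 0"
      using simple_quadrilateral_diagonal_splits assms(1) p by simp
    moreover have "orient a d c = - orient a c d" "orient a c b = - orient a b c"
        "orient d c b = - orient b c d" "orient d b a = - orient b d a"
      by (simp_all add: orient_def cross2_def algebra_simps)
    ultimately have "ccw [a, b, c, d] \<or> ccw [a, d, c, b]"
      by (auto simp: ccw_def zero_less_mult_iff)
    moreover have "edges [a, d, c, b] = edges [a, b, c, d]"
      by (auto simp: edges_quadrilateral closed_segment_commute)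
    moreover have "set [a, d, c, b] = set [a, b, c, d]"
      by auto
    ultimately show ?thesis
      unfolding p by metis
  qed
qed

lemma ccw_listing_from:
  assumes "ccw q" "x \<in> set q"
  shows "\<exists>r. ccw r \<and> set r = set q \<and> edges r = edges q \<and> hd r = x"
proof -
  have "ccw (rotate i q) \<and> edges (rotate i q) = edges q" for i
    by (induction i) (auto simp: assms(1) ccw_rotate1 edges_rotate1)
  moreover obtain i where "i < length q" "x = q ! i"
    using assms(2) by (auto simp: in_set_conv_nth)
  moreover have "hd (rotate i q) = q ! (i mod length q)"
    using \<open>i < length q\<close> by (intro hd_rotate_conv_nth) auto
  ultimately show ?thesis
    by (intro exI[of _ "rotate i q"]) auto
qed

lemma ccw_left_of:
  assumes "ccw q"
  shows "left_of (region q) (hd q) (q ! 1)" "left_of (region q) (last q) (hd q)"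
proof -
  have "left_of (region q) (hd q) (q ! 1) \<and> left_of (region q) (last q) (hd q)"
    using assms unfolding ccw_def
  proof (elim disjE exE conjE)
    fix a b c d assume "q = [a, b, c, d]" "orient b c d > 0" "orient b d a > 0"
    moreover have "region [a, b, c, d] = region [b, c, d, a]"
      by (intro region_cong) (auto simp: edges_quadrilateral)
    ultimately show ?thesis
      by (simp add: left_of_region_quadrilateral)
  qed (simp_all add: left_of_region_triangle left_of_region_quadrilateral)
  then show "left_of (region q) (hd q) (q ! 1)" "left_of (region q) (last q) (hd q)"
    by simp_all
qed

lemma ccw_edges_at_hd:
  assumes "ccw q"
  shows "closed_segment (hd q) y \<in> edges q \<longleftrightarrow> y = q ! 1 \<or> y = last q"
  using ccw_distinct[OF assms] assms unfolding ccw_def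
  by (auto simp: edges_triangle edges_quadrilateral doubleton_eq_iff)

lemma ccw_neighbours_distinct:
  assumes "ccw q"
  shows "q ! 1 \<noteq> hd q" "last q \<noteq> hd q" "q ! 1 \<noteq> last q"
  using ccw_distinct[OF assms] assms unfolding ccw_def by auto

section \<open>Outer normals and vertex normals\<close>

lemma unit_normal_cases:
  fixes u w :: plane
  assumes "norm u = 1" "u \<bullet> w = 0" "w \<noteq> 0"
  shows "u = (1 / norm w) *\<^sub>R perp w \<or> u = - (1 / norm w) *\<^sub>R perp w"
proof -
  define k where "k = cross2 w u / (w \<bullet> w)"
  have orth: "u $ 1 * w $ 1 + u $ 2 * w $ 2 = 0"
    using assms(2) by (simp add: inner_vec_def sum_2)
  have "(w \<bullet> w) *\<^sub>R u = cross2 w u *\<^sub>R perp w"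
  proof -
    have "(w $ 1 * w $ 1 + w $ 2 * w $ 2) * u $ 1 = (w $ 1 * u $ 2 - w $ 2 * u $ 1) * - w $ 2"
      using orth by algebra
    moreover have "(w $ 1 * w $ 1 + w $ 2 * w $ 2) * u $ 2 = (w $ 1 * u $ 2 - w $ 2 * u $ 1) * w $ 1"
      using orth by algebra
    ultimately show ?thesis
      by (simp add: vec_eq_iff forall_2 inner_vec_def sum_2 cross2_def)
  qed
  then have "(1 / (w \<bullet> w)) *\<^sub>R ((w \<bullet> w) *\<^sub>R u) = (1 / (w \<bullet> w)) *\<^sub>R (cross2 w u *\<^sub>R perp w)"
    by simp
  then have u: "u = k *\<^sub>R perp w"
    using assms(3) by (simp add: k_def)
  then have "\<bar>k\<bar> * norm w = 1"
    using assms(1) by simp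
  then have "k = 1 / norm w \<or> k = - (1 / norm w)"
    using assms(3) by (auto simp: field_simps abs_if split: if_splits)
  then show ?thesis
    using u by auto
qed

text \<open>The edge has two unit normals. Small steps along the one to the left stay in the region and small
steps along the other one leave it, so the latter is the only vector that passes the test.
Naming the ends of the edge twice lets the region be on the left of the direction from \<open>a\<close> to
\<open>b\<close> while the subedge may start at either end \<open>x\<close>.\<close>

lemma outer_normal_eq:
  assumes "x \<noteq> y" and left: "left_of (region p) a b" and ab: "{a, b} = {x, y}"
  shows "outer_normal p (x, midpoint x y) = - (1 / norm (b - a)) *\<^sub>R perp (b - a)"
proof -
  let ?R = "region p"
  \<comment> \<open>The midpoint of the subedge, a quarter of the way along the edge, is where normals are tested.\<close>
  define m where "m = midpoint x (midpoint x y)"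
  define k where "k = 1 / norm (b - a)"
  have "b \<noteq> a" using assms(1) ab by (auto simp: doubleton_eq_iff)
  then have k: "k > 0" by (simp add: k_def)
  have "m = (1 - 1/4) *\<^sub>R x + (1/4) *\<^sub>R y"
    by (simp add: m_def midpoint_def vec_eq_iff forall_2 algebra_simps)
  then have "m \<in> open_segment x y"
    unfolding in_segment using assms(1) by (intro conjI exI[of _ "1/4"]) auto
  then have "m \<in> open_segment a b"
    using ab by (auto simp: doubleton_eq_iff open_segment_commute)
  then obtain e where e: "e > 0" "\<And>t. 0 < t \<and> t < e \<Longrightarrow>
      m + t *\<^sub>R perp (b - a) \<in> interior ?R \<and> m - t *\<^sub>R perp (b - a) \<notin> ?R"
    using left unfolding left_of_def by meson
  have small: "0 < t * k \<and> t * k < e" if "0 < t" "t < e / k" for t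
    using that k by (simp add: field_simps)
  have out: "\<forall>\<^sub>F t in at_right 0. m + t *\<^sub>R (- k *\<^sub>R perp (b - a)) \<notin> ?R"
    unfolding eventually_at_right_field
    using e(2) small by (intro exI[of _ "e / k"]) (auto simp: e k)
  have inn: "\<forall>\<^sub>F t in at_right 0. m + t *\<^sub>R (k *\<^sub>R perp (b - a)) \<in> ?R"
    unfolding eventually_at_right_field
    using e(2) small interior_subset[of ?R] by (intro exI[of _ "e / k"]) (auto simp: e k)
  have par: "midpoint x y - x = (1/2) *\<^sub>R (b - a) \<or> midpoint x y - x = - (1/2) *\<^sub>R (b - a)"
    using ab by (auto simp: doubleton_eq_iff midpoint_def vec_eq_iff forall_2 algebra_simps)
  have orth_iff: "u \<bullet> (midpoint x y - x) = 0 \<longleftrightarrow> u \<bullet> (b - a) = 0" for u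
    using par by auto
  show ?thesis
    unfolding outer_normal_def fst_conv snd_conv m_def[symmetric] k_def[symmetric]
  proof (rule the_equality)
    have "perp (b - a) \<bullet> (b - a) = 0"
      by (simp add: inner_vec_def sum_2 algebra_simps)
    moreover have "norm (- k *\<^sub>R perp (b - a)) = 1"
      using \<open>b \<noteq> a\<close> by (simp add: k_def)
    ultimately show "norm (- k *\<^sub>R perp (b - a)) = 1 \<and> - k *\<^sub>R perp (b - a) \<bullet> (midpoint x y - x) = 0 \<and>
        (\<forall>\<^sub>F t in at_right 0. m + t *\<^sub>R (- k *\<^sub>R perp (b - a)) \<notin> ?R)"
      using out unfolding orth_iff by simp
  next
    fix u assume u: "norm u = 1 \<and> u \<bullet> (midpoint x y - x) = 0 \<and> (\<forall>\<^sub>F t in at_right 0. m + t *\<^sub>R u \<notin> ?R)"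
    have "u \<noteq> k *\<^sub>R perp (b - a)"
    proof
      assume "u = k *\<^sub>R perp (b - a)"
      then have "\<forall>\<^sub>F t in at_right 0. m + t *\<^sub>R (k *\<^sub>R perp (b - a)) \<notin> ?R"
        using u by blast
      with inn have "\<forall>\<^sub>F t in at_right (0::real). False"
        by eventually_elim simp
      then show False
        by (simp add: trivial_limit_at_right_real)
    qed
    then show "u = - k *\<^sub>R perp (b - a)"
      using unit_normal_cases[of u "b - a"] u \<open>b \<noteq> a\<close> unfolding orth_iff k_def by auto
  qed
qed

text \<open>The node-normal of a single polygon at one of its vertices.\<close>

definition vertex_normal :: "plane list \<Rightarrow> plane \<Rightarrow> plane" where
  "vertex_normal p x = (\<Sum>s\<in>subedges_at p x. sublength s *\<^sub>R outer_normal p s)"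

lemma vertex_normal_cong: "edges p = edges q \<Longrightarrow> vertex_normal p x = vertex_normal q x"
  by (simp add: vertex_normal_def subedges_at_def outer_normal_def region_def)

text \<open>The normal of a subedge times its length is half of the rotated edge vector, so the two edge
vectors at the vertex add up to the rotated vector between its two neighbours.\<close>

lemma vertex_normal_ccw:
  assumes "ccw q"
  shows "vertex_normal q (hd q) = (1/2) *\<^sub>R perp (last q - q ! 1)"
proof -
  define x y z where "x = hd q" "y = q ! 1" "z = last q"
  have ne: "y \<noteq> x" "z \<noteq> x" "y \<noteq> z"
    using ccw_neighbours_distinct[OF assms] by (simp_all add: x_y_z_def)
  have sub: "subedges_at q x = {(x, midpoint x y), (x, midpoint x z)}"
    unfolding subedges_at_def using ccw_edges_at_hd[OF assms] by (auto simp: x_y_z_def)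
  have "(x, midpoint x y) \<noteq> (x, midpoint x z)"
    using ne(3) by (simp add: midpoint_def)
  then have "vertex_normal q x =
      sublength (x, midpoint x y) *\<^sub>R outer_normal q (x, midpoint x y)
      + sublength (x, midpoint x z) *\<^sub>R outer_normal q (x, midpoint x z)"
    unfolding vertex_normal_def sub by simp
  also have "outer_normal q (x, midpoint x y) = - (1 / norm (y - x)) *\<^sub>R perp (y - x)"
    using ne ccw_left_of(1)[OF assms] by (intro outer_normal_eq) (auto simp: x_y_z_def)
  also have "outer_normal q (x, midpoint x z) = - (1 / norm (x - z)) *\<^sub>R perp (x - z)"
    using ne ccw_left_of(2)[OF assms] by (intro outer_normal_eq) (auto simp: x_y_z_def)
  also have "sublength (x, midpoint x y) = norm (y - x) / 2"
    using dist_midpoint[of x y] by (simp add: sublength_def dist_commute dist_norm norm_minus_commute)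
  also have "sublength (x, midpoint x z) = norm (x - z) / 2"
    using dist_midpoint[of x z] by (simp add: sublength_def dist_commute dist_norm norm_minus_commute)
  finally have "vertex_normal q x = - (1/2) *\<^sub>R perp (y - x) - (1/2) *\<^sub>R perp (x - z)"
    using ne by simp
  then show ?thesis
    by (simp add: perp_minus x_y_z_def algebra_simps)
qed

lemma vertex_normals_triangle:
  assumes "ccw [a, b, c]"
  shows "vertex_normal [a, b, c] a = (1/2) *\<^sub>R perp (c - b)"
    and "vertex_normal [a, b, c] b = (1/2) *\<^sub>R perp (a - c)"
    and "vertex_normal [a, b, c] c = (1/2) *\<^sub>R perp (b - a)"
proof -
  have c: "ccw [b, c, a]" "ccw [c, a, b]"
    using ccw_rotate1[OF assms] ccw_rotate1[of "[b, c, a]"] by simp_all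
  have e: "edges [a, b, c] = edges [b, c, a]" "edges [a, b, c] = edges [c, a, b]"
    by (auto simp: edges_triangle)
  show "vertex_normal [a, b, c] a = (1/2) *\<^sub>R perp (c - b)"
    using vertex_normal_ccw[OF assms] by simp
  show "vertex_normal [a, b, c] b = (1/2) *\<^sub>R perp (a - c)"
    using vertex_normal_ccw[OF c(1)] vertex_normal_cong[OF e(1)] by simp
  show "vertex_normal [a, b, c] c = (1/2) *\<^sub>R perp (b - a)"
    using vertex_normal_ccw[OF c(2)] vertex_normal_cong[OF e(2)] by simp
qed

lemma vertex_normals_quadrilateral:
  assumes "ccw [a, b, c, d]"
  shows "vertex_normal [a, b, c, d] a = (1/2) *\<^sub>R perp (d - b)"
    and "vertex_normal [a, b, c, d] b = (1/2) *\<^sub>R perp (a - c)"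
    and "vertex_normal [a, b, c, d] c = (1/2) *\<^sub>R perp (b - d)"
    and "vertex_normal [a, b, c, d] d = (1/2) *\<^sub>R perp (c - a)"
proof -
  have c: "ccw [b, c, d, a]" "ccw [c, d, a, b]" "ccw [d, a, b, c]"
    using ccw_rotate1[OF assms] ccw_rotate1[of "[b, c, d, a]"] ccw_rotate1[of "[c, d, a, b]"] by simp_all
  have e: "edges [a, b, c, d] = edges [b, c, d, a]" "edges [a, b, c, d] = edges [c, d, a, b]"
      "edges [a, b, c, d] = edges [d, a, b, c]"
    by (auto simp: edges_quadrilateral)
  show "vertex_normal [a, b, c, d] a = (1/2) *\<^sub>R perp (d - b)"
    using vertex_normal_ccw[OF assms] by simp
  show "vertex_normal [a, b, c, d] b = (1/2) *\<^sub>R perp (a - c)"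
    using vertex_normal_ccw[OF c(1)] vertex_normal_cong[OF e(1)] by simp
  show "vertex_normal [a, b, c, d] c = (1/2) *\<^sub>R perp (b - d)"
    using vertex_normal_ccw[OF c(2)] vertex_normal_cong[OF e(2)] by simp
  show "vertex_normal [a, b, c, d] d = (1/2) *\<^sub>R perp (c - a)"
    using vertex_normal_ccw[OF c(3)] vertex_normal_cong[OF e(3)] by simp
qed

lemma cross2_linear:
  "cross2 u (v + w) = cross2 u v + cross2 u w" "cross2 u (k *\<^sub>R v) = k * cross2 u v"
  "cross2 (k *\<^sub>R u) v = k * cross2 u v"
  by (simp_all add: cross2_def algebra_simps)

lemma area_ccw_quadrilateral:
  assumes "ccw [a, b, c, d]"
  shows "area [a, b, c, d] = cross2 (c - a) (d - b) / 2"
proof -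
  have "orient a b c > 0 \<and> orient a c d > 0 \<or> orient b c d > 0 \<and> orient b d a > 0"
    using assms by (auto simp: ccw_def)
  then show ?thesis
  proof (elim disjE conjE)
    assume "orient a b c > 0" "orient a c d > 0"
    then have "area [a, b, c, d] = (orient a b c + orient a c d) / 2"
      by (rule area_quadrilateral)
    then show ?thesis
      by (simp add: orient_def cross2_def algebra_simps)
  next
    assume "orient b c d > 0" "orient b d a > 0"
    then have "area [b, c, d, a] = (orient b c d + orient b d a) / 2"
      by (rule area_quadrilateral)
    moreover have "area [a, b, c, d] = area [b, c, d, a]"
      by (intro area_cong) (auto simp: edges_quadrilateral)
    ultimately show ?thesis
      by (simp add: orient_def cross2_def algebra_simps)
  qed
qed

text \<open>This is where at most four vertices are essential. The normals at two adjacent vertices have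
cross product \<open>\<plusminus>\<close> half of the area, and the normals at opposite vertices of a quadrilateral are
negatives of each other. Hence only the two neighbours of the first vertex contribute, with
coefficients independent of the shape of the polygon.\<close>

lemma cross2_vertex_normal_sum:
  assumes "ccw q"
  shows "cross2 (vertex_normal q (hd q)) (\<Sum>x\<in>set q. f x *\<^sub>R vertex_normal q x)
    = area q * ((f (q ! 1) - f (last q)) / 2)"
proof -
  have "(\<exists>a b c. q = [a, b, c] \<and> orient a b c > 0) \<or> (\<exists>a b c d. q = [a, b, c, d])"
    using assms unfolding ccw_def by blast
  then show ?thesis
  proof (elim disjE exE conjE)
    fix a b c assume q: "q = [a, b, c]" "orient a b c > 0"
    then have "(\<Sum>x\<in>set q. f x *\<^sub>R vertex_normal q x)
        = f a *\<^sub>R vertex_normal q a + (f b *\<^sub>R vertex_normal q b + f c *\<^sub>R vertex_normal q c)"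
      using ccw_distinct[OF assms] by simp
    moreover have "area q = cross2 (b - a) (c - a) / 2"
      using q by (simp add: area_triangle orient_def)
    moreover have "cross2 (perp (c - b)) (perp (c - b)) = 0"
        "cross2 (perp (c - b)) (perp (a - c)) = cross2 (b - a) (c - a)"
        "cross2 (perp (c - b)) (perp (b - a)) = - cross2 (b - a) (c - a)"
      by (simp_all add: cross2_def algebra_simps)
    ultimately show ?thesis
      using assms unfolding q
      by (simp add: vertex_normals_triangle cross2_linear) (simp add: field_simps)
  next
    fix a b c d assume q: "q = [a, b, c, d]"
    then have "(\<Sum>x\<in>set q. f x *\<^sub>R vertex_normal q x)
        = f a *\<^sub>R vertex_normal q a + (f b *\<^sub>R vertex_normal q b + (f c *\<^sub>R vertex_normal q c
          + f d *\<^sub>R vertex_normal q d))"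
      using ccw_distinct[OF assms] by simp
    moreover have "area q = cross2 (c - a) (d - b) / 2"
      using area_ccw_quadrilateral assms q by simp
    moreover have "cross2 (perp (d - b)) (perp (d - b)) = 0" "cross2 (perp (d - b)) (perp (b - d)) = 0"
        "cross2 (perp (d - b)) (perp (a - c)) = cross2 (c - a) (d - b)"
        "cross2 (perp (d - b)) (perp (c - a)) = - cross2 (c - a) (d - b)"
      by (simp_all add: cross2_def algebra_simps)
    ultimately show ?thesis
      using assms unfolding q
      by (simp add: vertex_normals_quadrilateral cross2_linear) (simp add: field_simps)
  qed
qed

lemma length_le_4_if_few_edges:
  assumes "simple_polygon p" "card (edges p) \<le> 4"
  shows "length p \<le> 4"
proof -
  have "inj_on (edge p) {..<length p}"
  proof (rule inj_onI, rule ccontr)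
    fix i j assume ij: "i \<in> {..<length p}" "j \<in> {..<length p}" "edge p i = edge p j" "i \<noteq> j"
    then have sub: "edge p i \<subseteq> {p ! i, p ! (Suc i mod length p)}"
      using assms(1) unfolding simple_polygon_def by (metis Int_absorb Int_subset_iff lessThan_iff)
    have "i \<noteq> Suc i mod length p"
      using assms(1) ij(1) unfolding simple_polygon_def
      by (cases "Suc i = length p") auto
    then have "p ! i \<noteq> p ! (Suc i mod length p)"
      using assms(1) ij(1) unfolding simple_polygon_def
      by (subst nth_eq_iff_index_eq) (auto intro: mod_less_divisor)
    then have "infinite (edge p i)"
      by (simp add: edge_def )
    then show False
      using sub finite_subset by blast
  qed
  then show ?thesis
    using assms(2) by (simp add: edges_def card_image)
qed

section \<open>Nodes, lifts and the cells at a node\<close>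

lemma edge_translate:
  assumes "i < length p"
  shows "edge (map ((+) l) p) i = (+) l ` edge p i"
proof -
  have "Suc i mod length p < length p"
    using assms by (intro mod_less_divisor) auto
  then show ?thesis
    using assms by (simp add: edge_def closed_segment_translation)
qed

lemma edges_translate: "edges (map ((+) l) p) = (`) ((+) l) ` edges p"
  unfolding edges_def image_image by (intro image_cong) (auto simp: edge_translate)

lemma ccw_translate:
  assumes "ccw q"
  shows "ccw (map ((+) l) q)"
proof -
  have "orient (l + a) (l + b) (l + c) = orient a b c" for a b c
    by (simp add: orient_def)
  then show ?thesis
    using assms unfolding ccw_def by auto
qed

context polygonal_grid
begin

lemma zero_period: "0 \<in> periods G"
  using plane_or_torus
proof (elim disjE exE conjE)
  fix a b assume "periods G = {of_int i *\<^sub>R a + of_int j *\<^sub>R b | i j. True}"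
  then show ?thesis
    by (auto intro!: exI[of _ 0])
qed simp

lemma diff_period:
  assumes "l \<in> periods G" "k \<in> periods G"
  shows "l - k \<in> periods G"
  using plane_or_torus
proof (elim disjE exE conjE)
  fix a b assume P: "periods G = {of_int i *\<^sub>R a + of_int j *\<^sub>R b | i j. True}"
  obtain i j i' j' where "l = of_int i *\<^sub>R a + of_int j *\<^sub>R b" "k = of_int i' *\<^sub>R a + of_int j' *\<^sub>R b"
    using assms unfolding P by blast
  then have "l - k = of_int (i - i') *\<^sub>R a + of_int (j - j') *\<^sub>R b"
    by (simp add: algebra_simps)
  then show ?thesis
    unfolding P by blast
qed (use assms in auto)

lemma add_period:
  assumes "l \<in> periods G" "k \<in> periods G"
  shows "l + k \<in> periods G"
  using diff_period[OF assms(1) diff_period[OF zero_period assms(2)]] by simp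

text \<open>Nodes are the cosets of a group of translations.\<close>

lemma node_eq_iff: "node G x = node G y \<longleftrightarrow> y - x \<in> periods G"
proof
  assume "node G x = node G y"
  moreover have "y + 0 \<in> node G y"
    unfolding node_def using zero_period by blast
  ultimately have "y \<in> node G x"
    by simp
  then show "y - x \<in> periods G"
    unfolding node_def by auto
next
  have sub: "node G y \<subseteq> node G x" if "y - x \<in> periods G" for x y
    unfolding node_def
  proof clarify
    fix l assume "l \<in> periods G"
    then have "y + l = x + ((y - x) + l)" "(y - x) + l \<in> periods G"
      using that add_period by auto
    then show "y + l \<in> (+) x ` periods G"
      by blast
  qed
  assume "y - x \<in> periods G"
  moreover from this have "x - y \<in> periods G"
    using diff_period[OF zero_period, of "y - x"] by simp
  ultimately show "node G x = node G y"
    using sub by blast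
qed

lemma node_translate: "l \<in> periods G \<Longrightarrow> node G (l + x) = node G x"
  using node_eq_iff[of x "l + x"] by simp

lemma mem_node_iff: "y \<in> node G x \<longleftrightarrow> y - x \<in> periods G"
  by (force simp: node_def)

lemma set_tile: "set (tile G c l) = (+) l ` set (verts G c)"
  by (simp add: tile_def)

lemma cells_at_node_iff:
  "c \<in> cells_at G (node G x) \<longleftrightarrow> c \<in> cells G \<and> (\<exists>l\<in>periods G. x \<in> set (tile G c l))"
proof -
  have "node G x \<in> nodes_of G c \<longleftrightarrow> (\<exists>l\<in>periods G. x \<in> set (tile G c l))"
  proof
    assume "node G x \<in> nodes_of G c"
    then obtain y where y: "y \<in> set (verts G c)" "node G y = node G x"
      by (auto simp: nodes_of_def)
    then have "x - y \<in> periods G" "x = (x - y) + y"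
      using node_eq_iff[of y x] by auto
    then show "\<exists>l\<in>periods G. x \<in> set (tile G c l)"
      unfolding set_tile using y(1) by blast
  next
    assume "\<exists>l\<in>periods G. x \<in> set (tile G c l)"
    then show "node G x \<in> nodes_of G c"
      by (auto simp: set_tile nodes_of_def node_translate)
  qed
  then show ?thesis
    by (simp add: cells_at_def)
qed

text \<open>The vertices of a cell are pairwise distinct as nodes, so only one lift of the cell has a vertex
at a given point, even on a torus.\<close>

lemma lift_at_node_unique:
  assumes "c \<in> cells G" "l \<in> periods G" "k \<in> periods G"
    and "x \<in> set (tile G c l)" "x \<in> set (tile G c k)"
  shows "l = k"
proof -
  obtain y z where yz: "y \<in> set (verts G c)" "x = l + y" "z \<in> set (verts G c)" "x = k + z"
    using assms(4,5) by (auto simp: set_tile)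
  then have "node G y = node G z"
    using node_translate[OF assms(2)] node_translate[OF assms(3)] by metis
  then have "y = z"
    using distinct_nodes[OF assms(1)] yz by (auto dest: inj_onD)
  then show ?thesis
    using yz by auto
qed

text \<open>Each cell at the node has a lift with vertex \<open>x\<close>, and this lift meets every ball around \<open>x\<close>.\<close>

lemma finite_cells_at:
  assumes "n \<in> nodes G"
  shows "finite (cells_at G n)"
proof -
  obtain x where n: "n = node G x"
    using assms by (auto simp: nodes_def nodes_of_def)
  obtain r where r: "r > 0" "finite {(c, l). c \<in> cells G \<and> l \<in> periods G \<and>
                              region (tile G c l) \<inter> ball x r \<noteq> {}}"
    using locally_finite by blast
  have "cells_at G n \<subseteq> fst ` {(c, l). c \<in> cells G \<and> l \<in> periods G \<and>
                              region (tile G c l) \<inter> ball x r \<noteq> {}}"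
  proof
    fix c assume "c \<in> cells_at G n"
    then obtain l where l: "c \<in> cells G" "l \<in> periods G" "x \<in> set (tile G c l)"
      unfolding n cells_at_node_iff by blast
    then have "region (tile G c l) \<inter> ball x r \<noteq> {}"
      using vertices_in_region[OF l(3)] r(1) by auto
    then show "c \<in> fst ` {(c, l). c \<in> cells G \<and> l \<in> periods G \<and>
                              region (tile G c l) \<inter> ball x r \<noteq> {}}"
      using l by (intro image_eqI[of _ _ "(c, l)"]) auto
  qed
  then show ?thesis
    using r(2) finite_subset by blast
qed

section \<open>Summation by parts\<close>

text \<open>Up to sign, both sides are the sum of \<open>\<phi> n\<close> times the cross product of the node-normal with \<open>v c\<close> over all
incident pairs of a node and a cell, summed in either order: the factors \<open>dual_area\<close> and \<open>area\<close>
cancel the normalizations of the two operators. Only finitely many pairs contribute.\<close>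

lemma summation_by_parts:
  assumes dual_area_pos: "\<And>n. n \<in> nodes G \<Longrightarrow> dual_area G n > 0"
    and fin: "finite {n \<in> nodes G. \<phi> n \<noteq> 0}"
  shows "(\<Sum>\<^sub>\<infinity>n\<in>nodes G. curl G v n * \<phi> n * dual_area G n) =
    - (\<Sum>\<^sub>\<infinity>c\<in>cells G. cross2 (grad G \<phi> c) (v c) * area (verts G c))"
proof -
  define S where "S = {n \<in> nodes G. \<phi> n \<noteq> 0}"
  define D where "D = (\<Union>n\<in>S. cells_at G n)"
  define w where "w n c = \<phi> n * cross2 (node_normal G n c) (v c)" for n c
  have finS: "finite S"
    using fin by (simp add: S_def)
  have finD: "finite D"
    unfolding D_def using finS finite_cells_at by (auto simp: S_def)
  have node_term: "curl G v n * \<phi> n * dual_area G n = - (\<Sum>c\<in>{c \<in> D. n \<in> nodes_of G c}. w n c)"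
    if "n \<in> S" for n
  proof -
    have "n \<in> nodes G"
      using that by (simp add: S_def)
    then have "dual_area G n \<noteq> 0"
      using dual_area_pos by force
    then have "curl G v n * \<phi> n * dual_area G n = - (\<Sum>c\<in>cells_at G n. w n c)"
      by (simp add: curl_def w_def mult.commute flip: sum_distrib_left)
    also have "cells_at G n = {c \<in> D. n \<in> nodes_of G c}"
      using that by (auto simp: D_def cells_at_def)
    finally show ?thesis .
  qed
  have cell_term: "cross2 (grad G \<phi> c) (v c) * area (verts G c) = (\<Sum>n\<in>{n \<in> S. n \<in> nodes_of G c}. w n c)"
    if "c \<in> cells G" for c
  proof -
    have lin: "cross2 (\<Sum>n\<in>A. \<phi> n *\<^sub>R node_normal G n c) (v c) = (\<Sum>n\<in>A. w n c)" for A
      by (induction A rule: infinite_finite_induct) (simp_all add: cross2_def w_def algebra_simps)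
    have "area (verts G c) \<noteq> 0"
      using area_pos[OF simple_cells[OF that]] by simp
    then have "cross2 (grad G \<phi> c) (v c) * area (verts G c) = cross2 (\<Sum>n\<in>nodes_of G c. \<phi> n *\<^sub>R node_normal G n c) (v c)"
      by (simp add: grad_def cross2_def field_simps)
    also have "\<dots> = (\<Sum>n\<in>nodes_of G c. w n c)"
      by (rule lin)
    also have "\<dots> = (\<Sum>n\<in>{n \<in> S. n \<in> nodes_of G c}. w n c)"
      using that by (intro sum.mono_neutral_right) (auto simp: nodes_of_def S_def nodes_def w_def)
    finally show ?thesis .
  qed
  have "(\<Sum>\<^sub>\<infinity>n\<in>nodes G. curl G v n * \<phi> n * dual_area G n) = (\<Sum>\<^sub>\<infinity>n\<in>S. curl G v n * \<phi> n * dual_area G n)"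
    by (intro infsum_cong_neutral) (auto simp: S_def)
  also have "\<dots> = - (\<Sum>n\<in>S. \<Sum>c\<in>{c \<in> D. n \<in> nodes_of G c}. w n c)"
    using finS node_term by (simp add: sum_negf)
  also have "(\<Sum>n\<in>S. \<Sum>c\<in>{c \<in> D. n \<in> nodes_of G c}. w n c) = (\<Sum>c\<in>D. \<Sum>n\<in>{n \<in> S. n \<in> nodes_of G c}. w n c)"
    by (intro sum.swap_restrict finS finD)
  also have "\<dots> = (\<Sum>\<^sub>\<infinity>c\<in>D. cross2 (grad G \<phi> c) (v c) * area (verts G c))"
    using finD cell_term by (simp add: D_def cells_at_def)
  also have "\<dots> = (\<Sum>\<^sub>\<infinity>c\<in>cells G. cross2 (grad G \<phi> c) (v c) * area (verts G c))"
  proof (rule infsum_cong_neutral)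
    fix c assume c: "c \<in> cells G - D"
    then have "{n \<in> S. n \<in> nodes_of G c} = {}"
      by (auto simp: D_def cells_at_def)
    then have "(\<Sum>n\<in>{n \<in> S. n \<in> nodes_of G c}. w n c) = 0"
      by (simp only: sum.empty)
    then show "cross2 (grad G \<phi> c) (v c) * area (verts G c) = 0"
      using cell_term c by (simp only: Diff_iff)
  qed (auto simp: D_def cells_at_def)
  finally show ?thesis .
qed

section \<open>Gradients have no curl\<close>

lemma node_normal_eq_vertex_normal:
  assumes "c \<in> cells G" "y \<in> set (verts G c)"
  shows "node_normal G (node G y) c = vertex_normal (verts G c) y"
proof -
  have "node G y \<inter> set (verts G c) = {y}"
  proof -
    have "z = y" if "z \<in> node G y" "z \<in> set (verts G c)" for z
      using that distinct_nodes[OF assms(1)] assms(2) node_eq_iff[of y z]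
      by (auto simp: mem_node_iff dest: inj_onD)
    then show ?thesis
      using assms(2) zero_period by (auto simp: mem_node_iff)
  qed
  then show ?thesis
    by (simp add: node_normal_def SE_def vertex_normal_def)
qed

text \<open>The division by the area in the gradient cancels the area in \<open>cross2_vertex_normal_sum\<close>.\<close>

lemma cross2_node_normal_grad:
  assumes c: "c \<in> cells G" and q: "ccw q" "set q = set (verts G c)" "edges q = edges (verts G c)"
  shows "cross2 (node_normal G (node G (hd q)) c) (grad G \<phi> c)
    = (\<phi> (node G (q ! 1)) - \<phi> (node G (last q))) / 2"
proof -
  have "hd q \<in> set (verts G c)"
  proof -
    have "q \<noteq> []"
      using q(1) by (auto simp: ccw_def)
    then show ?thesis
      unfolding q(2)[symmetric] by simp
  qed
  then have nn: "node_normal G (node G (hd q)) c = vertex_normal q (hd q)"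
    using node_normal_eq_vertex_normal[OF c] vertex_normal_cong[OF q(3)] by simp
  have "(\<Sum>n\<in>nodes_of G c. \<phi> n *\<^sub>R node_normal G n c) = (\<Sum>y\<in>set q. \<phi> (node G y) *\<^sub>R vertex_normal q y)"
    unfolding nodes_of_def q(2) sum.reindex[OF distinct_nodes[OF c]]
    using node_normal_eq_vertex_normal[OF c] vertex_normal_cong[OF q(3)]
    by (intro sum.cong) auto
  then have "cross2 (node_normal G (node G (hd q)) c) (grad G \<phi> c) = 1 / area (verts G c) *
      cross2 (vertex_normal q (hd q)) (\<Sum>y\<in>set q. \<phi> (node G y) *\<^sub>R vertex_normal q y)"
    by (simp only: nn grad_def cross2_linear)
  also have "\<dots> = 1 / area (verts G c) * (area q * ((\<phi> (node G (q ! 1)) - \<phi> (node G (last q))) / 2))"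
    by (simp only: cross2_vertex_normal_sum[OF q(1)])
  also have "area q = area (verts G c)"
    by (rule area_cong[OF q(3)])
  finally show ?thesis
    using area_pos[OF simple_cells[OF c]] by simp
qed

text \<open>Each cell at the node contributes half of the difference of the values of \<open>\<phi>\<close> at the successor
and at the predecessor of the node on its boundary. Each edge at the node belongs to two cells, which lie
on opposite sides of it, and so leads to the successor for one of them and to the predecessor for
the other. The contributions cancel in pairs.\<close>

lemma curl_grad_zero:
  assumes few: "\<And>c. c \<in> cells G \<Longrightarrow> card (edges (verts G c)) \<le> 4"
    and n: "n \<in> nodes G"
  shows "curl G (grad G \<phi>) n = 0"
proof -
  obtain x where x: "n = node G x"
    using n by (auto simp: nodes_def nodes_of_def)
  let ?C = "cells_at G n"
  define listing where "listing c l q \<longleftrightarrow> l \<in> periods G \<and> ccw q \<and> set q = set (tile G c l)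
      \<and> edges q = edges (tile G c l) \<and> hd q = x
      \<and> cross2 (node_normal G n c) (grad G \<phi> c) = (\<phi> (node G (q ! 1)) - \<phi> (node G (last q))) / 2"
    for c l q
  have "\<exists>l q. listing c l q"
    if c: "c \<in> ?C" for c
  proof -
    obtain l where l: "c \<in> cells G" "l \<in> periods G" "x \<in> set (tile G c l)"
      using c unfolding x cells_at_node_iff by blast
    then obtain y where y: "y \<in> set (verts G c)" "x = l + y"
      by (auto simp: set_tile)
    obtain r where "ccw r" "set r = set (verts G c)" "edges r = edges (verts G c)"
      using ccw_listing_exists[OF simple_cells[OF l(1)] length_le_4_if_few_edges[OF simple_cells[OF l(1)] few[OF l(1)]]]
      by blast
    then obtain r where r: "ccw r" "set r = set (verts G c)" "edges r = edges (verts G c)" "hd r = y"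
      using ccw_listing_from[of r y] y(1) by auto
    have ne: "r \<noteq> []" "1 < length r"
      using r(1) by (auto simp: ccw_def)
    \<comment> \<open>Normals are computed in the chosen lift of the cell, incidences in the lift that has \<open>x\<close> as a vertex.\<close>
    let ?q = "map ((+) l) r"
    have "node G (hd r) = n"
      using r(4) y(2) x node_translate[OF l(2)] by simp
    then have "cross2 (node_normal G n c) (grad G \<phi> c) = (\<phi> (node G (?q ! 1)) - \<phi> (node G (last ?q))) / 2"
      using cross2_node_normal_grad[OF l(1) r(1-3)] ne node_translate[OF l(2)] by (simp add: last_map)
    moreover have "ccw ?q" "set ?q = set (tile G c l)" "edges ?q = edges (tile G c l)" "hd ?q = x"
      using r y(2) ne ccw_translate by (simp_all add: set_tile tile_def edges_translate hd_map)
    ultimately show ?thesis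
      using l(2) unfolding listing_def by blast
  qed
  then obtain l q where "\<And>c. c \<in> ?C \<Longrightarrow> listing c (l c) (q c)"
    by metis
  then have l: "\<And>c. c \<in> ?C \<Longrightarrow> l c \<in> periods G"
    and q: "\<And>c. c \<in> ?C \<Longrightarrow> ccw (q c)" "\<And>c. c \<in> ?C \<Longrightarrow> set (q c) = set (tile G c (l c))"
      "\<And>c. c \<in> ?C \<Longrightarrow> edges (q c) = edges (tile G c (l c))" "\<And>c. c \<in> ?C \<Longrightarrow> hd (q c) = x"
    and contribution: "\<And>c. c \<in> ?C \<Longrightarrow> cross2 (node_normal G n c) (grad G \<phi> c)
        = (\<phi> (node G (q c ! 1)) - \<phi> (node G (last (q c)))) / 2"
    by (simp_all add: listing_def)
  \<comment> \<open>Neighbours of \<open>x\<close> in the counterclockwise order of the boundary of the cell.\<close>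
  define succ pred where "succ c = q c ! 1" and "pred c = last (q c)" for c
  have left: "left_of (region (tile G c (l c))) x (succ c)" "left_of (region (tile G c (l c))) (pred c) x"
      and neighbours: "\<And>y. closed_segment x y \<in> edges (tile G c (l c)) \<longleftrightarrow> y = succ c \<or> y = pred c"
      and ne: "succ c \<noteq> x" "pred c \<noteq> x" and x_vertex: "x \<in> set (tile G c (l c))"
    if "c \<in> ?C" for c
  proof -
    show "left_of (region (tile G c (l c))) x (succ c)" "left_of (region (tile G c (l c))) (pred c) x"
      using ccw_left_of[OF q(1)[OF that]] region_cong[OF q(3)[OF that]] q(4)[OF that]
      by (simp_all add: succ_def pred_def)
    show "closed_segment x y \<in> edges (tile G c (l c)) \<longleftrightarrow> y = succ c \<or> y = pred c" for y
      using ccw_edges_at_hd[OF q(1)[OF that]] q(3,4)[OF that] by (simp add: succ_def pred_def)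
    show "succ c \<noteq> x" "pred c \<noteq> x"
      using ccw_neighbours_distinct[OF q(1)[OF that]] q(4)[OF that] by (simp_all add: succ_def pred_def)
    have "hd (q c) \<in> set (q c)"
      using q(1)[OF that] by (intro hd_in_set) (auto simp: ccw_def)
    then show "x \<in> set (tile G c (l c))"
      using q(2,4)[OF that] by simp
  qed
  have same_side: "c = c'" if "c \<in> ?C" "c' \<in> ?C" "a \<noteq> b"
      and R: "left_of (region (tile G c (l c))) a b" "left_of (region (tile G c' (l c'))) a b" for c c' a b
  proof (rule ccontr)
    assume "c \<noteq> c'"
    have "interior (region (tile G c (l c))) \<inter> interior (region (tile G c' (l c'))) \<noteq> {}"
      using left_of_same_edge_interiors_meet[OF \<open>a \<noteq> b\<close> R] .
    moreover have "interior (region (tile G c (l c))) \<inter> interior (region (tile G c' (l c'))) = {}"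
      using that(1,2) l \<open>c \<noteq> c'\<close> by (intro nonoverlapping) (auto simp: cells_at_def)
    ultimately show False
      by blast
  qed
  have inj_succ: "inj_on succ ?C"
  proof (rule inj_onI)
    fix c c' assume "c \<in> ?C" "c' \<in> ?C" "succ c = succ c'"
    then show "c = c'"
      using same_side[of c c' x "succ c"] left(1)[of c] left(1)[of c'] ne(1)[of c] by metis
  qed
  have inj_pred: "inj_on pred ?C"
  proof (rule inj_onI)
    fix c c' assume "c \<in> ?C" "c' \<in> ?C" "pred c = pred c'"
    then show "c = c'"
      using same_side[of c c' "pred c" x] left(2)[of c] left(2)[of c'] ne(2)[of c] by metis
  qed
  have "succ ` ?C \<subseteq> pred ` ?C"
  proof clarify
    fix c assume c: "c \<in> ?C"
    then have cG: "c \<in> cells G"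
      by (simp add: cells_at_def)
    \<comment> \<open>The sharing of edges is known for the chosen lift of \<open>c\<close>: translate the edge there and back.\<close>
    have "closed_segment x (succ c) \<in> (`) ((+) (l c)) ` edges (verts G c)"
      using neighbours[OF c] unfolding tile_def edges_translate by blast
    then obtain e where e: "e \<in> edges (verts G c)" "closed_segment x (succ c) = (+) (l c) ` e"
      by blast
    let ?K = "{c' \<in> cells G. \<exists>k\<in>periods G. e \<in> edges (tile G c' k)}"
    have "card ?K = 2"
      using edge_shared_by_two[OF cG e(1)] .
    have "\<not> ?K \<subseteq> {c}"
    proof
      assume "?K \<subseteq> {c}"
      then have "card ?K \<le> card {c}"
        by (intro card_mono) auto
      then show False
        using \<open>card ?K = 2\<close> by simp
    qed
    then obtain c' k where k: "c' \<in> cells G" "c' \<noteq> c" "k \<in> periods G" "e \<in> edges (tile G c' k)"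
      by blast
    define k' where "k' = l c + k"
    have "closed_segment x (succ c) \<in> edges (map ((+) (l c)) (tile G c' k))"
      using k(4) e(2) by (simp add: edges_translate)
    also have "map ((+) (l c)) (tile G c' k) = tile G c' k'"
      by (simp add: tile_def k'_def add.assoc)
    finally have e': "closed_segment x (succ c) \<in> edges (tile G c' k')" .
    have k': "k' \<in> periods G"
      using add_period[OF l[OF c] k(3)] by (simp add: k'_def)
    have xk: "x \<in> set (tile G c' k')"
    proof -
      obtain i where i: "i < length (tile G c' k')"
          "closed_segment x (succ c) = closed_segment (tile G c' k' ! i) (tile G c' k' ! (Suc i mod length (tile G c' k')))"
        using e' by (auto simp: edges_def edge_def)
      then have "x \<in> {tile G c' k' ! i, tile G c' k' ! (Suc i mod length (tile G c' k'))}"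
        unfolding closed_segment_eq by blast
      moreover have "Suc i mod length (tile G c' k') < length (tile G c' k')"
        using i(1) by (intro mod_less_divisor) auto
      ultimately show ?thesis
        using i(1) nth_mem by blast
    qed
    then have c': "c' \<in> ?C"
      unfolding x cells_at_node_iff using k(1) k' by blast
    have "k' = l c'"
      using lift_at_node_unique[OF k(1) k' l[OF c'] xk x_vertex[OF c']] .
    then have "succ c = succ c' \<or> succ c = pred c'"
      using e' neighbours[OF c'] by simp
    moreover have "succ c \<noteq> succ c'"
      using inj_succ c c' k(2) by (auto dest: inj_onD)
    ultimately show "succ c \<in> pred ` ?C"
      using c' by blast
  qed
  moreover have fin: "finite ?C"
    using finite_cells_at n by blast
  ultimately have image_eq: "succ ` ?C = pred ` ?C"
    using inj_succ inj_pred by (intro card_subset_eq) (simp_all add: card_image)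
  have "(\<Sum>c\<in>?C. cross2 (node_normal G n c) (grad G \<phi> c))
      = ((\<Sum>c\<in>?C. \<phi> (node G (succ c))) - (\<Sum>c\<in>?C. \<phi> (node G (pred c)))) / 2"
    by (simp add: contribution succ_def pred_def sum_subtractf flip: sum_divide_distrib)
  also have "(\<Sum>c\<in>?C. \<phi> (node G (succ c))) = (\<Sum>y\<in>succ ` ?C. \<phi> (node G y))"
    by (simp add: sum.reindex[OF inj_succ])
  also have "\<dots> = (\<Sum>c\<in>?C. \<phi> (node G (pred c)))"
    unfolding image_eq by (simp add: sum.reindex[OF inj_pred])
  finally show ?thesis
    by (simp add: curl_def)
qed

end

theorem theorem5p2:
  fixes G :: "'c grid"
  assumes grid: "polygonal_grid G"
    and dual_area_pos: "\<And>n. n \<in> nodes G \<Longrightarrow> dual_area G n > 0"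
  shows "(\<forall>v \<phi>. finite {n \<in> nodes G. \<phi> n \<noteq> 0} \<longrightarrow>
            (\<Sum>\<^sub>\<infinity>n\<in>nodes G. curl G v n * \<phi> n * dual_area G n) =
            - (\<Sum>\<^sub>\<infinity>c\<in>cells G. cross2 (grad G \<phi> c) (v c) * area (verts G c)))
       \<and> ((\<forall>c\<in>cells G. card (edges (verts G c)) \<le> 4) \<longrightarrow>
            (\<forall>\<phi>. \<forall>n\<in>nodes G. curl G (grad G \<phi>) n = 0))"
proof -
  interpret polygonal_grid G
    by (rule grid)
  show ?thesis
    using summation_by_parts dual_area_pos curl_grad_zero by blast
qed

end
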